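(* Let $p,q\ge0$ be integers with $p+q\le n-1$, or with $p+q=n$ and $pq=0$, and let $k=p+q$. Then, on $V_0^{p,q}$, $$\Delta_k=\Delta_0+i(q-p)T.$$
   Context: **Group and forms.** Let $n\ge 1$. $H_n=\mathbb C^n\times\mathbb R$ with product $(z,t)(z',t')=(z+z',t+t'-\frac12\operatorname{Im}\langle z,z'\rangle)$. Put $Z_j=\sqrt2(\partial_{z_j}-\frac i4\bar z_j\partial_t)$, $\bar Z_j=\sqrt2(\partial_{\bar z_j}+\frac i4z_j\partial_t)$, $T=\partial_t$ (left-invariant vector fields), with dual forms $\zeta_j=dz_j/\sqrt2$, $\bar\zeta_j=d\bar z_j/\sqrt2$, $\theta=dt+\frac i4\sum_j(\bar z_jdz_j-z_jd\bar z_j)$. The left-invariant Riemannian metric is the one for which these frames are orthonormal. $\Lambda^{p,q}$ is the span of $\zeta^I\wedge\bar\zeta^{I'}$, $|I|=p,|I'|=q$; $E\Lambda^{p,q}=E\otimes\Lambda^{p,q}$ for a function space $E$. $\partial\omega=\sum_j\zeta_j\wedge Z_j\omega$, $\bar\partial\omega=\sum_j\bar\zeta_j\wedge\bar Z_j\omega$, $d_H=\partial+\bar\partial$; $\partial^*,\bar\partial^*,d_H^*$ are $L^2$-adjoints. $\Delta_k=dd^*+d^*d$ is the Hodge Laplacian on $k$-forms. $L=-\sum_j(Z_j\bar Z_j+\bar Z_jZ_j)$; on the right-hand side of the identity $\Delta_0=L-T^2$ and $T$ act as scalar operators, i.e. on each coefficient of a form with respect to the basis of forms built from $\zeta_j,\bar\zeta_j,\theta$.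 **The core $\mathcal S_0$.** $\mathcal F$ is the Hilbert space of entire $F$ on $\mathbb C^n$ with $\int|F(w)|^2e^{-|w|^2/2}dw<\infty$; $\pi_1(z,t)F(w)=e^{it}e^{-\frac12\langle w,z\rangle-\frac14|z|^2}F(w+z)$, $\pi_\lambda(z,t)=\pi_1(\lambda^{1/2}z,\lambda t)$ for $\lambda>0$, $\pi_\lambda(z,t)=\pi_{-\lambda}(\bar z,-t)$ for $\lambda<0$; $\pi_\lambda(f)=\int f(x)\pi_\lambda(x)^{-1}dx$. $P_j$ is the orthogonal projection of $\mathcal F$ onto homogeneous polynomials of degree $j$. $\mathcal S_0$ is the space of Schwartz functions $f$ for which there are $0<\delta<R$ and $N\in\mathbb N$ with $\pi_\lambda(f)=0$ for $|\lambda|\le\delta$ or $|\lambda|\ge R$, and $P_j\pi_\lambda(f)=0$ for $j>N$. ($T$ is invertible on $\mathcal S_0$.) **The space.** $W_0^{p,q}=\{\omega\in\mathcal S_0\Lambda^{p,q}:\partial^*\omega=\bar\partial^*\omega=0\}$ and $V_0^{p,q}=\Phi(W_0^{p,q})$, where $\Phi(\omega)=\omega+\theta\wedge T^{-1}d_H^*\omega$. *)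

theory Defs
  imports "HOL-Analysis.Analysis"
begin

section \<open>Functions and left-invariant vector fields on the Heisenberg group\<close>

text \<open>The underlying manifold of the Heisenberg group, with \<open>n = CARD('n)\<close>.  The group law enters
  only through the left-invariant fields and forms and through the representations below; Haar
  measure and Riemannian volume are Lebesgue measure.\<close>

type_synonym 'n heis = "(complex ^ 'n) \<times> real"

definition dir_deriv :: "'n heis \<Rightarrow> ('n::finite heis \<Rightarrow> complex) \<Rightarrow> 'n heis \<Rightarrow> complex" where
  "dir_deriv v f = (\<lambda>x. frechet_derivative f (at x) v)"

definition schwartz :: "('n::finite heis \<Rightarrow> complex) \<Rightarrow> bool" where
  "schwartz f \<longleftrightarrow> (\<forall>vs. foldr dir_deriv vs f differentiable_on UNIV \<and>
     (\<forall>N::nat. \<exists>C::real. \<forall>x. norm x ^ N * norm (foldr dir_deriv vs f x) \<le> C))"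

definition d_z :: "'n \<Rightarrow> ('n::finite heis \<Rightarrow> complex) \<Rightarrow> 'n heis \<Rightarrow> complex" where
  "d_z j f = (\<lambda>x. (dir_deriv (axis j 1, 0) f x - \<i> * dir_deriv (axis j \<i>, 0) f x) / 2)"

definition d_zbar :: "'n \<Rightarrow> ('n::finite heis \<Rightarrow> complex) \<Rightarrow> 'n heis \<Rightarrow> complex" where
  "d_zbar j f = (\<lambda>x. (dir_deriv (axis j 1, 0) f x + \<i> * dir_deriv (axis j \<i>, 0) f x) / 2)"

definition vfT :: "('n::finite heis \<Rightarrow> complex) \<Rightarrow> 'n heis \<Rightarrow> complex" where
  "vfT f = dir_deriv (0, 1) f"

definition vfZ :: "'n \<Rightarrow> ('n::finite heis \<Rightarrow> complex) \<Rightarrow> 'n heis \<Rightarrow> complex" where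
  "vfZ j f = (\<lambda>x. complex_of_real (sqrt 2) * (d_z j f x - \<i> / 4 * cnj (fst x $ j) * vfT f x))"

definition vfZbar :: "'n \<Rightarrow> ('n::finite heis \<Rightarrow> complex) \<Rightarrow> 'n heis \<Rightarrow> complex" where
  "vfZbar j f = (\<lambda>x. complex_of_real (sqrt 2) * (d_zbar j f x + \<i> / 4 * (fst x $ j) * vfT f x))"

definition sublaplacian :: "('n::finite heis \<Rightarrow> complex) \<Rightarrow> 'n heis \<Rightarrow> complex" where
  "sublaplacian f = (\<lambda>x. - (\<Sum>j\<in>UNIV. vfZ j (vfZbar j f) x + vfZbar j (vfZ j f) x))"

definition scalar_laplacian :: "('n::finite heis \<Rightarrow> complex) \<Rightarrow> 'n heis \<Rightarrow> complex" where
  "scalar_laplacian f = (\<lambda>x. sublaplacian f x - vfT (vfT f) x)"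


section \<open>Differential forms\<close>

text \<open>A complex-valued differential form is a function of a base point and a list of real tangent
  vectors.  A \<open>k\<close>-form vanishes on lists of length other than \<open>k\<close>; multilinearity and
  alternation hold for all elements of the spaces \<open>span_forms\<close> below.\<close>

type_synonym 'n form = "'n heis \<Rightarrow> 'n heis list \<Rightarrow> complex"

definition zeta :: "'n \<Rightarrow> 'n::finite heis \<Rightarrow> 'n heis \<Rightarrow> complex" where
  "zeta j x v = (fst v $ j) / complex_of_real (sqrt 2)"

definition zetabar :: "'n \<Rightarrow> 'n::finite heis \<Rightarrow> 'n heis \<Rightarrow> complex" where
  "zetabar j x v = cnj (fst v $ j) / complex_of_real (sqrt 2)"

definition theta :: "'n::finite heis \<Rightarrow> 'n heis \<Rightarrow> complex" where
  "theta x v = complex_of_real (snd v)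
     + \<i> / 4 * (\<Sum>j\<in>UNIV. cnj (fst x $ j) * (fst v $ j) - (fst x $ j) * cnj (fst v $ j))"

text \<open>Exterior product of a 1-form with a form, with the normalization in which a product of
  1-forms is the determinant of their values.\<close>

definition wedge :: "('n heis \<Rightarrow> 'n heis \<Rightarrow> complex) \<Rightarrow> 'n form \<Rightarrow> 'n form" where
  "wedge \<alpha> \<omega> = (\<lambda>x vs. \<Sum>i<length vs.
     (-1) ^ i * \<alpha> x (vs ! i) * \<omega> x (take i vs @ drop (Suc i) vs))"

text \<open>The exterior derivative in the affine coordinates \<open>(z, t)\<close>, i.e. on constant vector fields,
  whose brackets vanish.\<close>

definition ext_d :: "'n::finite form \<Rightarrow> 'n form" where
  "ext_d \<omega> = (\<lambda>x vs. \<Sum>i<length vs.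
     (-1) ^ i * dir_deriv (vs ! i) (\<lambda>y. \<omega> y (take i vs @ drop (Suc i) vs)) x)"

text \<open>The index \<open>(I, J, b)\<close> stands for the product of \<open>zeta\<close> over \<open>I\<close> and \<open>zetabar\<close> over \<open>J\<close>, each in
  increasing order, preceded by \<open>theta\<close> if \<open>b\<close>.  The linear order on \<open>'n\<close> only fixes signs.\<close>

type_synonym 'n findex = "'n set \<times> 'n set \<times> bool"

fun basis_form :: "'n::{finite,linorder} findex \<Rightarrow> 'n form" where
  "basis_form (I, J, b) = foldr wedge
     ((if b then [theta] else []) @ map zeta (sorted_list_of_set I) @ map zetabar (sorted_list_of_set J))
     (\<lambda>x vs. if vs = [] then 1 else 0)"

definition form_of :: "('n::{finite,linorder} findex \<Rightarrow> 'n heis \<Rightarrow> complex) \<Rightarrow> 'n form" where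
  "form_of c = (\<lambda>x vs. \<Sum>A\<in>UNIV. c A x * basis_form A x vs)"

text \<open>The basis forms are linearly independent at every point, so coefficients are unique.\<close>

definition coeffs :: "'n::{finite,linorder} form \<Rightarrow> 'n findex \<Rightarrow> 'n heis \<Rightarrow> complex" where
  "coeffs \<omega> = (THE c. \<omega> = form_of c)"

definition coeffwise ::
  "(('n heis \<Rightarrow> complex) \<Rightarrow> 'n heis \<Rightarrow> complex) \<Rightarrow> 'n::{finite,linorder} form \<Rightarrow> 'n form" where
  "coeffwise P \<omega> = form_of (\<lambda>A. P (coeffs \<omega> A))"

text \<open>\<open>span_forms E S\<close> is the tensor product of the function space \<open>E\<close> with the span of the basis
  forms indexed by \<open>S\<close>.\<close>

definition span_forms ::
  "('n heis \<Rightarrow> complex) set \<Rightarrow> 'n findex set \<Rightarrow> 'n::{finite,linorder} form set" where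
  "span_forms E S = {form_of c | c. (\<forall>A\<in>S. c A \<in> E) \<and> (\<forall>A. A \<notin> S \<longrightarrow> c A = (\<lambda>x. 0))}"

definition bideg :: "nat \<Rightarrow> nat \<Rightarrow> 'n findex set" where
  "bideg p q = {(I, J, b). card I = p \<and> card J = q \<and> \<not> b}"

definition horizontal :: "'n findex set" where
  "horizontal = {(I, J, b). \<not> b}"

definition deg :: "nat \<Rightarrow> 'n findex set" where
  "deg k = {(I, J, b). card I + card J + of_bool b = k}"

definition del :: "'n::{finite,linorder} form \<Rightarrow> 'n form" where
  "del \<omega> = (\<lambda>x vs. \<Sum>j\<in>UNIV. wedge (zeta j) (coeffwise (vfZ j) \<omega>) x vs)"

definition delbar :: "'n::{finite,linorder} form \<Rightarrow> 'n form" where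
  "delbar \<omega> = (\<lambda>x vs. \<Sum>j\<in>UNIV. wedge (zetabar j) (coeffwise (vfZbar j) \<omega>) x vs)"

definition d_H :: "'n::{finite,linorder} form \<Rightarrow> 'n form" where
  "d_H \<omega> = (\<lambda>x vs. del \<omega> x vs + delbar \<omega> x vs)"


section \<open>Adjoints and the Hodge Laplacian\<close>

text \<open>The metric makes the frame orthonormal, hence also the basis forms.\<close>

definition l2_inner :: "'n::{finite,linorder} form \<Rightarrow> 'n form \<Rightarrow> complex" where
  "l2_inner \<omega> \<eta> = (\<integral>x. (\<Sum>A\<in>UNIV. coeffs \<omega> A x * cnj (coeffs \<eta> A x)) \<partial>lborel)"

text \<open>\<open>l2_adjoint D P\<close> is the adjoint of \<open>P\<close> with domain \<open>D\<close>.  Taking the value in \<open>D\<close> selects the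
  smooth representative; it is used for spaces \<open>D\<close> of Schwartz forms and differential operators \<open>P\<close>
  with polynomial coefficients, whose adjoints map Schwartz forms to Schwartz forms.\<close>

definition l2_adjoint ::
  "'n::{finite,linorder} form set \<Rightarrow> ('n form \<Rightarrow> 'n form) \<Rightarrow> 'n form \<Rightarrow> 'n form" where
  "l2_adjoint D P \<omega> = (THE \<eta>. \<eta> \<in> D \<and> (\<forall>\<phi>\<in>D. l2_inner (P \<phi>) \<omega> = l2_inner \<phi> \<eta>))"

abbreviation del_adj :: "'n::{finite,linorder} form \<Rightarrow> 'n form" where
  "del_adj \<equiv> l2_adjoint (span_forms (Collect schwartz) horizontal) del"

abbreviation delbar_adj :: "'n::{finite,linorder} form \<Rightarrow> 'n form" where
  "delbar_adj \<equiv> l2_adjoint (span_forms (Collect schwartz) horizontal) delbar"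

abbreviation d_H_adj :: "'n::{finite,linorder} form \<Rightarrow> 'n form" where
  "d_H_adj \<equiv> l2_adjoint (span_forms (Collect schwartz) horizontal) d_H"

text \<open>\<open>codiff k\<close> is the adjoint, on \<open>k\<close>-forms, of \<open>ext_d\<close> on \<open>(k - 1)\<close>-forms.\<close>

fun codiff :: "nat \<Rightarrow> 'n::{finite,linorder} form \<Rightarrow> 'n form" where
  "codiff 0 \<omega> = (\<lambda>x vs. 0)"
| "codiff (Suc m) \<omega> = l2_adjoint (span_forms (Collect schwartz) (deg m)) ext_d \<omega>"

definition hodge_laplacian :: "nat \<Rightarrow> 'n::{finite,linorder} form \<Rightarrow> 'n form" where
  "hodge_laplacian k \<omega> = (\<lambda>x vs. ext_d (codiff k \<omega>) x vs + codiff (Suc k) (ext_d \<omega>) x vs)"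


section \<open>Bargmann representations and the core\<close>

definition entire :: "(complex ^ 'n::finite \<Rightarrow> complex) \<Rightarrow> bool" where
  "entire F \<longleftrightarrow> (\<forall>w. \<exists>F'. (F has_derivative F') (at w) \<and> (\<forall>c v. F' (c *s v) = c * F' v))"

definition fock :: "(complex ^ 'n::finite \<Rightarrow> complex) set" where
  "fock = {F. entire F \<and> integrable lborel (\<lambda>w. (norm (F w))\<^sup>2 * exp (- (norm w)\<^sup>2 / 2))}"

definition fock_inner ::
  "(complex ^ 'n::finite \<Rightarrow> complex) \<Rightarrow> (complex ^ 'n \<Rightarrow> complex) \<Rightarrow> complex" where
  "fock_inner F G = (\<integral>w. F w * cnj (G w) * complex_of_real (exp (- (norm w)\<^sup>2 / 2)) \<partial>lborel)"

definition herm :: "complex ^ 'n::finite \<Rightarrow> complex ^ 'n \<Rightarrow> complex" where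
  "herm w z = (\<Sum>j\<in>UNIV. (w $ j) * cnj (z $ j))"

definition rep1 :: "'n::finite heis \<Rightarrow> (complex ^ 'n \<Rightarrow> complex) \<Rightarrow> complex ^ 'n \<Rightarrow> complex" where
  "rep1 x F = (\<lambda>w. exp (\<i> * complex_of_real (snd x))
     * exp (- herm w (fst x) / 2 - complex_of_real ((norm (fst x))\<^sup>2) / 4) * F (w + fst x))"

text \<open>Only used for \<open>l \<noteq> 0\<close>.\<close>

definition rep ::
  "real \<Rightarrow> 'n::finite heis \<Rightarrow> (complex ^ 'n \<Rightarrow> complex) \<Rightarrow> complex ^ 'n \<Rightarrow> complex" where
  "rep l x = (if l > 0 then rep1 (sqrt l *\<^sub>R fst x, l * snd x)
     else rep1 (sqrt (- l) *\<^sub>R (\<chi> j. cnj (fst x $ j)), - l * (- snd x)))"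

text \<open>For integrable \<open>f\<close> and \<open>F\<close> in the Fock space, where point evaluations are continuous, the
  operator-valued integral is given by this absolutely convergent pointwise integral.\<close>

definition rep_fun ::
  "real \<Rightarrow> ('n::finite heis \<Rightarrow> complex) \<Rightarrow> (complex ^ 'n \<Rightarrow> complex) \<Rightarrow> complex ^ 'n \<Rightarrow> complex" where
  "rep_fun l f F = (\<lambda>w. \<integral>x. f x * inv_into fock (rep l x) F w \<partial>lborel)"

definition hom_poly :: "nat \<Rightarrow> (complex ^ 'n::finite \<Rightarrow> complex) set" where
  "hom_poly j = {(\<lambda>w. \<Sum>\<alpha> | (\<Sum>i\<in>UNIV. \<alpha> i) = j. c \<alpha> * (\<Prod>i\<in>UNIV. (w $ i) ^ \<alpha> i))
     | c :: ('n \<Rightarrow> nat) \<Rightarrow> complex. True}"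

definition fock_proj :: "nat \<Rightarrow> (complex ^ 'n::finite \<Rightarrow> complex) \<Rightarrow> complex ^ 'n \<Rightarrow> complex" where
  "fock_proj j F = (THE G. G \<in> hom_poly j \<and> (\<forall>H\<in>hom_poly j. fock_inner (\<lambda>w. F w - G w) H = 0))"

definition core :: "('n::finite heis \<Rightarrow> complex) set" where
  "core = {f. schwartz f \<and> (\<exists>(\<delta>::real) (R::real) (N::nat). 0 < \<delta> \<and> \<delta> < R \<and>
     (\<forall>l F. l \<noteq> 0 \<and> (\<bar>l\<bar> \<le> \<delta> \<or> \<bar>l\<bar> \<ge> R) \<and> F \<in> fock \<longrightarrow> rep_fun l f F = (\<lambda>w. 0)) \<and>
     (\<forall>l F j. l \<noteq> 0 \<and> F \<in> fock \<and> j > N \<longrightarrow> fock_proj j (rep_fun l f F) = (\<lambda>w. 0)))}"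


section \<open>The spaces\<close>

definition W0 :: "nat \<Rightarrow> nat \<Rightarrow> 'n::{finite,linorder} form set" where
  "W0 p q = {\<omega> \<in> span_forms core (bideg p q).
     del_adj \<omega> = (\<lambda>x vs. 0) \<and> delbar_adj \<omega> = (\<lambda>x vs. 0)}"

text \<open>The field \<open>vfT\<close> is a bijection of \<open>core\<close> onto itself.\<close>

definition Phi :: "'n::{finite,linorder} form \<Rightarrow> 'n form" where
  "Phi \<omega> = (\<lambda>x vs. \<omega> x vs + wedge theta (coeffwise (the_inv_into core vfT) (d_H_adj \<omega>)) x vs)"

definition V0 :: "nat \<Rightarrow> nat \<Rightarrow> 'n::{finite,linorder} form set" where
  "V0 p q = Phi ` W0 p q"

end

theory Submission
  imports Defs
begin

text \<open>On \<open>W0\<close> the correction term of \<open>Phi\<close> vanishes, because the adjoint of \<open>d_H\<close> is the sum of the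
  adjoints of \<open>del\<close> and \<open>delbar\<close>; so \<open>V0\<close> consists of the forms \<open>\<omega>\<close> in \<open>W0\<close> themselves.
  The anticommutator of the two adjoints is a multiple of \<open>T \<Lambda>\<close>, with \<open>\<Lambda>\<close> the contraction
  with \<open>d\<theta>\<close>, and \<open>T\<close> is injective on Schwartz functions, so \<open>\<Lambda> \<omega> = 0\<close>.  Hence the
  codifferential of \<open>\<omega>\<close> is zero.  In the codifferential of \<open>d \<omega> = d_H \<omega> + \<theta> \<and> T \<omega>\<close> the
  \<open>\<theta>\<close>-component vanishes by the Kaehler-type identities for \<open>[\<Lambda>, del]\<close> and \<open>[\<Lambda>, delbar]\<close>,
  and the horizontal component is the sum of the two Kohn Laplacians minus \<open>T\<^sup>2 \<omega>\<close>.
  The relation \<open>[Z j, Zbar k] = \<i> T\<close> for \<open>j = k\<close> (and \<open>0\<close> otherwise) turns that sum into the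
  sublaplacian plus \<open>\<i> (q - p) T\<close>.\<close>

section \<open>Schwartz functions\<close>

text \<open>The adjoints, the inverse of \<open>T\<close>, the coefficients of a form and the Fock
  projections are definite descriptions, so each use requires a candidate in the prescribed space
  together with uniqueness. For the adjoints the candidate comes from integration by parts, and
  uniqueness from definiteness of the inner product on continuous coefficients. On \<open>W0\<close>
  the inverse of \<open>T\<close> is evaluated at zero only, but its value there depends on zero
  lying in \<open>core\<close>, hence on the projections of zero being determined; this is where the
  Fock space enters. Adjoints are computed on families of Schwartz coefficients. Exterior product
  and contraction with coframe elements act on them as creation and annihilation operators, which
  satisfy the canonical anticommutation relations and commute with the fields, so each identity
  reduces to its diagonal terms j = k. There the commutator \<i> T multiplies the number operators
  that count the zeta and zetabar factors. The two counts enter with opposite signs because Z j and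
  Zbar j exchange roles, whence q - p.\<close>

declare split_paired_All [simp del] split_paired_Ex [simp del]

section \<open>Rules for directional derivatives\<close>

lemma dir_deriv_eq:
  assumes "(f has_derivative f') (at x)"
  shows "dir_deriv v f x = f' v"
  using frechet_derivative_at[OF assms] by (simp add: dir_deriv_def)

lemma dir_deriv_const: "dir_deriv v (\<lambda>x. c) = (\<lambda>x. 0)"
  by (rule ext, rule dir_deriv_eq[where f' = "\<lambda>_. 0", simplified]) simp

lemma dir_deriv_bounded_linear:
  assumes "bounded_linear l"
  shows "dir_deriv v l x = l v"
  by (rule dir_deriv_eq[OF bounded_linear_imp_has_derivative[OF assms]])

lemma dir_deriv_add:
  assumes "f differentiable at x" "g differentiable at x"
  shows "dir_deriv v (\<lambda>x. f x + g x) x = dir_deriv v f x + dir_deriv v g x"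
  using dir_deriv_eq[OF has_derivative_add[OF assms[unfolded frechet_derivative_works]]]
  by (simp add: dir_deriv_def)

lemma dir_deriv_sum:
  assumes "\<And>i. i \<in> I \<Longrightarrow> f i differentiable at x"
  shows "dir_deriv v (\<lambda>x. \<Sum>i\<in>I. f i x) x = (\<Sum>i\<in>I. dir_deriv v (f i) x)"
proof -
  have "((\<lambda>x. \<Sum>i\<in>I. f i x) has_derivative (\<lambda>h. \<Sum>i\<in>I. frechet_derivative (f i) (at x) h)) (at x)"
    by (rule has_derivative_sum) (use assms frechet_derivative_works in blast)
  from dir_deriv_eq[OF this] show ?thesis by (simp add: dir_deriv_def)
qed

lemma dir_deriv_mult:
  assumes "f differentiable at x" "g differentiable at x"
  shows "dir_deriv v (\<lambda>x. f x * g x) x = f x * dir_deriv v g x + dir_deriv v f x * g x"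
  using dir_deriv_eq[OF has_derivative_mult[OF assms[unfolded frechet_derivative_works]]]
  by (simp add: dir_deriv_def)

lemma dir_deriv_cmult:
  assumes "f differentiable at x"
  shows "dir_deriv v (\<lambda>x. c * f x) x = c * dir_deriv v f x"
  using dir_deriv_mult[of "\<lambda>_. c", OF _ assms] by (simp add: dir_deriv_const)

lemma dir_deriv_cnj:
  assumes "f differentiable at x"
  shows "dir_deriv v (\<lambda>x. cnj (f x)) x = cnj (dir_deriv v f x)"
proof -
  have "((\<lambda>x. cnj (f x)) has_derivative (\<lambda>h. cnj (frechet_derivative f (at x) h))) (at x)"
    by (rule bounded_linear.has_derivative[OF bounded_linear_cnj])
       (use assms frechet_derivative_works in blast)
  from dir_deriv_eq[OF this] show ?thesis by (simp add: dir_deriv_def)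
qed

lemma dir_deriv_linear:
  assumes "f differentiable at x"
  shows "linear (\<lambda>v. dir_deriv v f x)"
  using linear_frechet_derivative[OF assms] by (simp add: dir_deriv_def)

lemma has_vector_derivative_line:
  assumes "\<And>x. f differentiable at x"
  shows "((\<lambda>s. f (x + s *\<^sub>R v)) has_vector_derivative dir_deriv v f (x + s *\<^sub>R v)) (at s)"
proof -
  have "((\<lambda>s. x + s *\<^sub>R v) has_derivative (\<lambda>h. h *\<^sub>R v)) (at s)"
    by (auto intro!: derivative_eq_intros)
  from has_derivative_compose[OF this, of f] assms[of "x + s *\<^sub>R v"]
  have "((\<lambda>s. f (x + s *\<^sub>R v)) has_derivative
      (\<lambda>h. frechet_derivative f (at (x + s *\<^sub>R v)) (h *\<^sub>R v))) (at s)"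
    using frechet_derivative_works by blast
  then show ?thesis
    unfolding has_vector_derivative_def dir_deriv_def
    by (simp add: linear_cmul[OF linear_frechet_derivative[OF assms]])
qed

text \<open>An invariant preserved by one derivative is preserved by every list of them, so a
  closure proof only has to find a shape of function that differentiation reproduces.\<close>

lemma schwartz_coinduct [consumes 1, case_names deriv diff decay]:
  assumes "P f"
    and deriv: "\<And>f v. P f \<Longrightarrow> P (dir_deriv v f)"
    and diff: "\<And>f x. P f \<Longrightarrow> f differentiable at x"
    and decay: "\<And>f N. P f \<Longrightarrow> \<exists>C. \<forall>x. norm x ^ N * norm (f x) \<le> C"
  shows "schwartz f"
proof -
  have "P (foldr dir_deriv vs f)" for vs
    by (induction vs) (auto intro: assms)
  then show ?thesis
    unfolding schwartz_def using diff decay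
    by (meson differentiable_at_imp_differentiable_on)
qed

lemma schwartz_dir_deriv: "schwartz f \<Longrightarrow> schwartz (dir_deriv v f)"
  unfolding schwartz_def
proof
  fix vs
  assume a: "\<forall>vs. foldr dir_deriv vs f differentiable_on UNIV \<and>
     (\<forall>N::nat. \<exists>C::real. \<forall>x. norm x ^ N * norm (foldr dir_deriv vs f x) \<le> C)"
  show "foldr dir_deriv vs (dir_deriv v f) differentiable_on UNIV \<and>
     (\<forall>N::nat. \<exists>C::real. \<forall>x. norm x ^ N * norm (foldr dir_deriv vs (dir_deriv v f) x) \<le> C)"
    \<comment> \<open>\<open>foldr\<close> applies the last entry first, so appending
      \<open>v\<close> makes it the innermost derivative.\<close>
    using spec[OF a, of "vs @ [v]"] by simp
qed

lemma schwartz_differentiable: "schwartz f \<Longrightarrow> f differentiable at x"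
  unfolding schwartz_def
  by (drule spec[of _ "[]"]) (auto simp: differentiable_on_def)

lemma schwartz_decay: "schwartz f \<Longrightarrow> \<exists>C. \<forall>x. norm x ^ N * norm (f x) \<le> C"
  unfolding schwartz_def by (drule spec[of _ "[]"]) auto

lemma schwartz_continuous: "schwartz f \<Longrightarrow> continuous_on S f"
  by (intro continuous_at_imp_continuous_on ballI differentiable_imp_continuous_within
      schwartz_differentiable)

lemma decay_nonneg:
  assumes "\<exists>C. \<forall>x. norm x ^ N * norm (f x) \<le> C"
  obtains C where "C \<ge> 0" "\<And>x. norm x ^ N * norm (f x) \<le> C"
proof -
  obtain C where C: "\<And>x. norm x ^ N * norm (f x) \<le> C" using assms by blast
  have "0 \<le> norm (0::'a) ^ N * norm (f 0)" by simp
  also note C[of 0]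
  finally have "0 \<le> C" .
  with C that show ?thesis by blast
qed

lemma schwartz_zero: "schwartz (\<lambda>x. 0)"
  by (rule schwartz_coinduct[where P = "\<lambda>f. f = (\<lambda>x. 0)"]) (auto simp: dir_deriv_const)

lemma decay_add:
  fixes f g :: "'a::real_normed_vector \<Rightarrow> complex"
  assumes "\<exists>C. \<forall>x. norm x ^ N * norm (f x) \<le> C" "\<exists>C. \<forall>x. norm x ^ N * norm (g x) \<le> C"
  shows "\<exists>C. \<forall>x. norm x ^ N * norm (f x + g x) \<le> C"
proof -
  obtain C D where C: "\<And>x. norm x ^ N * norm (f x) \<le> C" "\<And>x. norm x ^ N * norm (g x) \<le> D"
    using assms by blast
  have "norm x ^ N * norm (f x + g x) \<le> C + D" for x
  proof -
    have "norm x ^ N * norm (f x + g x) \<le> norm x ^ N * (norm (f x) + norm (g x))"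
      by (intro mult_left_mono norm_triangle_ineq) auto
    then show ?thesis using C[of x] by (simp add: distrib_left)
  qed
  then show ?thesis by blast
qed

lemma schwartz_add:
  assumes "schwartz f" "schwartz g"
  shows "schwartz (\<lambda>x. f x + g x)"
proof (rule schwartz_coinduct[where P = "\<lambda>h. \<exists>f g. schwartz f \<and> schwartz g \<and> h = (\<lambda>x. f x + g x)"])
  show "\<exists>f' g'. schwartz f' \<and> schwartz g' \<and> (\<lambda>x. f x + g x) = (\<lambda>x. f' x + g' x)"
    using assms by blast
next
  fix h v assume "\<exists>f g. schwartz f \<and> schwartz g \<and> h = (\<lambda>x. f x + g x)"
  then obtain f g where "schwartz f" "schwartz g" "h = (\<lambda>x. f x + g x)" by blast
  then have "dir_deriv v h = (\<lambda>x. dir_deriv v f x + dir_deriv v g x)"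
    by (auto simp: dir_deriv_add schwartz_differentiable)
  then show "\<exists>f g. schwartz f \<and> schwartz g \<and> dir_deriv v h = (\<lambda>x. f x + g x)"
    using \<open>schwartz f\<close> \<open>schwartz g\<close> schwartz_dir_deriv by blast
next
  fix h :: "'a heis \<Rightarrow> complex" and x assume "\<exists>f g. schwartz f \<and> schwartz g \<and> h = (\<lambda>x. f x + g x)"
  then show "h differentiable at x"
    by (auto intro!: differentiable_add intro: schwartz_differentiable)
next
  fix h :: "'a heis \<Rightarrow> complex" and N assume "\<exists>f g. schwartz f \<and> schwartz g \<and> h = (\<lambda>x. f x + g x)"
  then show "\<exists>C. \<forall>x. norm x ^ N * norm (h x) \<le> C"
    by (elim exE conjE) (simp add: decay_add schwartz_decay)
qed

text \<open>The Leibniz rule turns one product into two, so products alone are not stable under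
  differentiation; their sums are, and serve as the invariant for
  \<open>schwartz_mult\<close>.\<close>

inductive schwartz_products :: "('n::finite heis \<Rightarrow> complex) \<Rightarrow> bool" where
  prod: "schwartz f \<Longrightarrow> schwartz g \<Longrightarrow> schwartz_products (\<lambda>x. f x * g x)"
| add: "schwartz_products f \<Longrightarrow> schwartz_products g \<Longrightarrow> schwartz_products (\<lambda>x. f x + g x)"

lemma schwartz_products_differentiable: "schwartz_products f \<Longrightarrow> f differentiable at x"
  by (induction rule: schwartz_products.induct)
     (auto intro!: differentiable_mult intro: schwartz_differentiable)

lemma schwartz_mult:
  assumes "schwartz f" "schwartz g"
  shows "schwartz (\<lambda>x. f x * g x)"
proof (rule schwartz_coinduct[where P = schwartz_products])
  show "schwartz_products (\<lambda>x. f x * g x)" using assms by (rule schwartz_products.prod)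
next
  fix f :: "'a heis \<Rightarrow> complex" and v assume "schwartz_products f"
  then show "schwartz_products (dir_deriv v f)"
  proof induction
    case (prod f g)
    have "dir_deriv v (\<lambda>x. f x * g x) = (\<lambda>x. f x * dir_deriv v g x + dir_deriv v f x * g x)"
      using prod by (auto simp: dir_deriv_mult schwartz_differentiable)
    then show ?case
      using prod by (auto intro!: schwartz_products.intros schwartz_dir_deriv)
  next
    case (add f g)
    have "dir_deriv v (\<lambda>x. f x + g x) = (\<lambda>x. dir_deriv v f x + dir_deriv v g x)"
      using add by (auto simp: dir_deriv_add schwartz_products_differentiable)
    then show ?case using add by (auto intro!: schwartz_products.intros)
  qed
next
  fix f :: "'a heis \<Rightarrow> complex" and N assume "schwartz_products f"
  then show "\<exists>C. \<forall>x. norm x ^ N * norm (f x) \<le> C"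
  proof induction
    case (prod f g)
    obtain C where C: "C \<ge> 0" "\<And>x. norm x ^ N * norm (f x) \<le> C"
      using decay_nonneg[OF schwartz_decay[OF prod(1)]] by blast
    \<comment> \<open>One factor supplies the decay, the other only a bound, which is its decay
      estimate with exponent 0.\<close>
    obtain D where D: "\<And>x. norm (g x) \<le> D"
      using schwartz_decay[OF prod(2), of 0] by auto
    have "norm x ^ N * norm (f x * g x) \<le> C * D" for x
      using mult_mono[OF C(2)[of x] D[of x] C(1)] by (simp add: norm_mult mult.assoc)
    then show ?case by blast
  qed (rule decay_add)
qed (rule schwartz_products_differentiable)

lemma schwartz_cnj:
  assumes "schwartz f"
  shows "schwartz (\<lambda>x. cnj (f x))"
proof (rule schwartz_coinduct[where P = "\<lambda>h. \<exists>f. schwartz f \<and> h = (\<lambda>x. cnj (f x))"])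
  fix h :: "'a heis \<Rightarrow> complex" and x assume "\<exists>f. schwartz f \<and> h = (\<lambda>x. cnj (f x))"
  then obtain f where f: "schwartz f" "h = (\<lambda>x. cnj (f x))" by blast
  from schwartz_differentiable[OF f(1)] show "h differentiable at x"
    unfolding f differentiable_def by (blast intro: bounded_linear.has_derivative[OF bounded_linear_cnj])
next
  fix h v assume "\<exists>f. schwartz f \<and> h = (\<lambda>x. cnj (f x))"
  then obtain f where "schwartz f" "h = (\<lambda>x. cnj (f x))" by blast
  then have "dir_deriv v h = (\<lambda>x. cnj (dir_deriv v f x))"
    by (auto simp: dir_deriv_cnj schwartz_differentiable)
  then show "\<exists>f. schwartz f \<and> dir_deriv v h = (\<lambda>x. cnj (f x))"
    using \<open>schwartz f\<close> schwartz_dir_deriv by blast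
qed (use assms schwartz_decay in auto)

lemma schwartz_cmult:
  assumes fg: "schwartz f"
  shows "schwartz (\<lambda>x. c * f x)"
proof (rule schwartz_coinduct[where P = "\<lambda>h. \<exists>f. schwartz f \<and> h = (\<lambda>x. c * f x)"])
  show "\<exists>f'. schwartz f' \<and> (\<lambda>x. c * f x) = (\<lambda>x. c * f' x)" using fg by blast
  fix h w assume "\<exists>f. schwartz f \<and> h = (\<lambda>x. c * f x)"
  then obtain f where "schwartz f" "h = (\<lambda>x. c * f x)" by blast
  then have "dir_deriv w h = (\<lambda>x. c * dir_deriv w f x)"
    by (auto simp: dir_deriv_cmult schwartz_differentiable)
  then show "\<exists>f. schwartz f \<and> dir_deriv w h = (\<lambda>x. c * f x)"
    using \<open>schwartz f\<close> schwartz_dir_deriv by blast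
next
  fix h :: "'a heis \<Rightarrow> complex" and N assume "\<exists>f. schwartz f \<and> h = (\<lambda>x. c * f x)"
  then obtain f where f: "schwartz f" "h = (\<lambda>x. c * f x)" by blast
  obtain C where C: "\<And>x. norm x ^ N * norm (f x) \<le> C"
    using schwartz_decay[OF f(1)] by blast
  have "norm x ^ N * norm (h x) \<le> norm (c) * C" for x
    using mult_left_mono[OF C[of x], of "norm (c)"] by (simp add: f norm_mult mult_ac)
  then show "\<exists>C. \<forall>x. norm x ^ N * norm (h x) \<le> C" by blast
qed (auto intro!: differentiable_mult intro: schwartz_differentiable)

text \<open>Differentiating the linear factor leaves the constant \<open>l v\<close>, so the
  invariant is an affine factor times a Schwartz function plus a second Schwartz function that
  absorbs such terms.\<close>

lemma schwartz_linear_mult: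
  assumes l: "bounded_linear l" and "schwartz f"
  shows "schwartz (\<lambda>x. l x * f x)"
proof (rule schwartz_coinduct[where
      P = "\<lambda>h. \<exists>f g c. schwartz f \<and> schwartz g \<and> h = (\<lambda>x. (c + l x) * f x + g x)"])
  show "\<exists>f' g c. schwartz f' \<and> schwartz g \<and> (\<lambda>x. l x * f x) = (\<lambda>x. (c + l x) * f' x + g x)"
    using assms(2) schwartz_zero
    by (intro exI[of _ f] exI[of _ "\<lambda>x. 0"] exI[of _ 0]) auto
next
  fix h v assume "\<exists>f g c. schwartz f \<and> schwartz g \<and> h = (\<lambda>x. (c + l x) * f x + g x)"
  then obtain f g c where fg: "schwartz f" "schwartz g" and h: "h = (\<lambda>x. (c + l x) * f x + g x)"
    by blast
  have "dir_deriv v h x = (c + l x) * dir_deriv v f x + (l v * f x + dir_deriv v g x)" for x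
    unfolding h using fg l bounded_linear_imp_differentiable[OF l]
    by (subst dir_deriv_add dir_deriv_mult | simp add: schwartz_differentiable
        dir_deriv_const dir_deriv_bounded_linear)+
  then have *: "dir_deriv v h = (\<lambda>x. (c + l x) * dir_deriv v f x + (l v * f x + dir_deriv v g x))"
    by blast
  have "schwartz (\<lambda>x. l v * f x)" using fg by (intro schwartz_cmult)
  then show "\<exists>f g c. schwartz f \<and> schwartz g \<and> dir_deriv v h = (\<lambda>x. (c + l x) * f x + g x)"
    unfolding * using fg by (blast intro: schwartz_add schwartz_dir_deriv)
next
  fix h :: "'a heis \<Rightarrow> complex" and x assume "\<exists>f g c. schwartz f \<and> schwartz g \<and> h = (\<lambda>x. (c + l x) * f x + g x)"
  then show "h differentiable at x"
    by (auto intro!: differentiable_add differentiable_mult bounded_linear_imp_differentiable[OF l]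
        intro: schwartz_differentiable)
next
  fix h :: "'a heis \<Rightarrow> complex" and N assume "\<exists>f g c. schwartz f \<and> schwartz g \<and> h = (\<lambda>x. (c + l x) * f x + g x)"
  then obtain f g c where fg: "schwartz f" "schwartz g" and h: "h = (\<lambda>x. (c + l x) * f x + g x)"
    by blast
  obtain K where K: "\<And>x. norm (l x) \<le> norm x * K" using bounded_linear.bounded[OF l] by blast
  obtain C where C: "\<And>x. norm x ^ N * norm (f x) \<le> C" using schwartz_decay[OF fg(1)] by blast
  \<comment> \<open>The linear factor costs one power of the norm, paid for by the next decay
    estimate.\<close>
  obtain D where D: "\<And>x. norm x ^ Suc N * norm (f x) \<le> D" using schwartz_decay[OF fg(1)] by blast
  have "norm x ^ N * norm ((c + l x) * f x) \<le> norm c * C + \<bar>K\<bar> * D" for x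
  proof -
    have "norm (c + l x) \<le> norm c + \<bar>K\<bar> * norm x"
      using norm_triangle_ineq[of c "l x"] K[of x] mult_left_mono[OF abs_ge_self[of K], of "norm x"]
      by (simp add: mult.commute)
    then have "norm x ^ N * norm ((c + l x) * f x) \<le> norm x ^ N * ((norm c + \<bar>K\<bar> * norm x) * norm (f x))"
      by (simp add: norm_mult mult_left_mono mult_right_mono)
    also have "\<dots> = norm c * (norm x ^ N * norm (f x)) + \<bar>K\<bar> * (norm x ^ Suc N * norm (f x))"
      by (simp add: algebra_simps)
    also have "\<dots> \<le> norm c * C + \<bar>K\<bar> * D"
      by (intro add_mono mult_left_mono C D) auto
    finally show ?thesis .
  qed
  then show "\<exists>C. \<forall>x. norm x ^ N * norm (h x) \<le> C"
    unfolding h by (intro decay_add schwartz_decay[OF fg(2)]) blast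
qed

section \<open>Commuting derivatives and integration by parts\<close>

text \<open>The mean value theorem is applied along \<open>v\<close> to a difference in direction
  \<open>w\<close>, then along \<open>w\<close>. It requires real values, hence the functional
  \<open>L\<close>.\<close>

lemma second_difference_mean_value:
  assumes f: "schwartz f" and L: "bounded_linear (L :: complex \<Rightarrow> real)" and "h > 0"
  shows "\<exists>\<xi> \<eta>. 0 < \<xi> \<and> \<xi> < h \<and> 0 < \<eta> \<and> \<eta> < h \<and>
    L (f (x + h *\<^sub>R v + h *\<^sub>R w)) - L (f (x + h *\<^sub>R w)) - L (f (x + h *\<^sub>R v)) + L (f x)
    = h * h * L (dir_deriv w (dir_deriv v f) (x + \<xi> *\<^sub>R v + \<eta> *\<^sub>R w))"
proof -
  have line: "((\<lambda>s. L (g (y + s *\<^sub>R u))) has_real_derivative L (dir_deriv u g (y + s *\<^sub>R u))) (at s)"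
    if "schwartz g" for g y u s
    using bounded_linear.has_vector_derivative[OF L
        has_vector_derivative_line[OF schwartz_differentiable[OF that]]]
    by (simp add: has_real_derivative_iff_has_vector_derivative)
  define A where "A = (\<lambda>s. L (f (x + h *\<^sub>R w + s *\<^sub>R v)) - L (f (x + s *\<^sub>R v)))"
  define A' where "A' = (\<lambda>s. L (dir_deriv v f (x + h *\<^sub>R w + s *\<^sub>R v)) - L (dir_deriv v f (x + s *\<^sub>R v)))"
  have "(A has_real_derivative A' s) (at s)" for s
    unfolding A_def A'_def by (intro DERIV_diff line f)
  then obtain \<xi> where \<xi>: "0 < \<xi>" "\<xi> < h" "A h - A 0 = (h - 0) * A' \<xi>"
    using MVT2[of 0 h A A'] \<open>h > 0\<close> by blast
  obtain \<eta> where \<eta>: "0 < \<eta>" "\<eta> < h"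
    "L (dir_deriv v f ((x + \<xi> *\<^sub>R v) + h *\<^sub>R w)) - L (dir_deriv v f ((x + \<xi> *\<^sub>R v) + 0 *\<^sub>R w))
     = (h - 0) * L (dir_deriv w (dir_deriv v f) ((x + \<xi> *\<^sub>R v) + \<eta> *\<^sub>R w))"
    using MVT2[OF \<open>h > 0\<close>, of "\<lambda>s. L (dir_deriv v f ((x + \<xi> *\<^sub>R v) + s *\<^sub>R w))"
        "\<lambda>s. L (dir_deriv w (dir_deriv v f) ((x + \<xi> *\<^sub>R v) + s *\<^sub>R w))"]
      line[OF schwartz_dir_deriv[OF f]] by blast
  show ?thesis
    using \<xi> \<eta> unfolding A_def A'_def
    by (intro exI[of _ \<xi>] exI[of _ \<eta>]) (simp add: algebra_simps)
qed

text \<open>Schwarz's theorem. The second difference is symmetric in \<open>v\<close> and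
  \<open>w\<close>, so the mean values found in the two orders agree; their points tend to
  \<open>x\<close> as \<open>h\<close> shrinks, and the second derivatives are continuous.\<close>

lemma dir_deriv_commute:
  fixes f :: "'n::finite heis \<Rightarrow> complex"
  assumes f: "schwartz f"
  shows "dir_deriv v (dir_deriv w f) = dir_deriv w (dir_deriv v f)"
proof
  fix x :: "'n heis"
  have close: "\<exists>h0>0. \<forall>\<xi> \<eta>. 0 < \<xi> \<and> \<xi> < h0 \<and> 0 < \<eta> \<and> \<eta> < h0 \<longrightarrow>
      norm (g (x + \<xi> *\<^sub>R v + \<eta> *\<^sub>R w) - g x) < e"
    if g: "schwartz g" and "e > 0" for g :: "'n heis \<Rightarrow> complex" and e v w
  proof -
    have "isCont g x"
      using differentiable_imp_continuous_within[OF schwartz_differentiable[OF g]] by blast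
    then obtain d where d: "d > 0" "\<And>y. dist y x < d \<Longrightarrow> dist (g y) (g x) < e"
      using \<open>e > 0\<close> unfolding continuous_at_eps_delta by blast
    define h0 where "h0 = d / (norm v + norm w + 1)"
    have pos: "norm v + norm w + 1 > 0" by (simp add: add_nonneg_pos)
    have "norm (g (x + \<xi> *\<^sub>R v + \<eta> *\<^sub>R w) - g x) < e" if "0 < \<xi>" "\<xi> < h0" "0 < \<eta>" "\<eta> < h0" for \<xi> \<eta>
    proof -
      have "norm (\<xi> *\<^sub>R v + \<eta> *\<^sub>R w) \<le> \<xi> * norm v + \<eta> * norm w"
        using norm_triangle_ineq[of "\<xi> *\<^sub>R v" "\<eta> *\<^sub>R w"] that by simp
      also have "\<dots> \<le> h0 * norm v + h0 * norm w"
        using that by (intro add_mono mult_right_mono) auto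
      also have "\<dots> < h0 * (norm v + norm w + 1)"
        using that by (simp add: algebra_simps)
      also have "\<dots> = d" unfolding h0_def using pos by simp
      finally have "dist (x + \<xi> *\<^sub>R v + \<eta> *\<^sub>R w) x < d"
        by (simp add: dist_norm add.assoc)
      then show ?thesis using d(2) by (simp add: dist_norm)
    qed
    moreover have "h0 > 0" unfolding h0_def using d pos by simp
    ultimately show ?thesis by blast
  qed
  have "L (dir_deriv v (dir_deriv w f) x) = L (dir_deriv w (dir_deriv v f) x)"
    if L: "bounded_linear L" and L1: "\<And>z. \<bar>L z\<bar> \<le> norm z" for L :: "complex \<Rightarrow> real"
  proof (rule ccontr)
    assume neq: "L (dir_deriv v (dir_deriv w f) x) \<noteq> L (dir_deriv w (dir_deriv v f) x)"
    \<comment> \<open>Half the gap: values within less than \<open>e\<close> of either side cannot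
      coincide.\<close>
    define e where "e = \<bar>L (dir_deriv v (dir_deriv w f) x) - L (dir_deriv w (dir_deriv v f) x)\<bar> / 2"
    have "e > 0" using neq by (simp add: e_def)
    obtain h1 where h1: "h1 > 0" "\<And>\<xi> \<eta>. 0 < \<xi> \<Longrightarrow> \<xi> < h1 \<Longrightarrow> 0 < \<eta> \<Longrightarrow> \<eta> < h1 \<Longrightarrow>
        norm (dir_deriv w (dir_deriv v f) (x + \<xi> *\<^sub>R v + \<eta> *\<^sub>R w) - dir_deriv w (dir_deriv v f) x) < e"
      using close[OF schwartz_dir_deriv[OF schwartz_dir_deriv[OF f]] \<open>e > 0\<close>] by metis
    obtain h2 where h2: "h2 > 0" "\<And>\<xi> \<eta>. 0 < \<xi> \<Longrightarrow> \<xi> < h2 \<Longrightarrow> 0 < \<eta> \<Longrightarrow> \<eta> < h2 \<Longrightarrow>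
        norm (dir_deriv v (dir_deriv w f) (x + \<xi> *\<^sub>R w + \<eta> *\<^sub>R v) - dir_deriv v (dir_deriv w f) x) < e"
      using close[OF schwartz_dir_deriv[OF schwartz_dir_deriv[OF f]] \<open>e > 0\<close>] by metis
    define h where "h = min h1 h2"
    have "h > 0" using h1 h2 by (simp add: h_def)
    obtain \<xi> \<eta> where a: "0 < \<xi>" "\<xi> < h" "0 < \<eta>" "\<eta> < h"
      "L (f (x + h *\<^sub>R v + h *\<^sub>R w)) - L (f (x + h *\<^sub>R w)) - L (f (x + h *\<^sub>R v)) + L (f x)
       = h * h * L (dir_deriv w (dir_deriv v f) (x + \<xi> *\<^sub>R v + \<eta> *\<^sub>R w))"
      using second_difference_mean_value[OF f L \<open>h > 0\<close>] by blast
    obtain \<xi>' \<eta>' where b: "0 < \<xi>'" "\<xi>' < h" "0 < \<eta>'" "\<eta>' < h"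
      "L (f (x + h *\<^sub>R w + h *\<^sub>R v)) - L (f (x + h *\<^sub>R v)) - L (f (x + h *\<^sub>R w)) + L (f x)
       = h * h * L (dir_deriv v (dir_deriv w f) (x + \<xi>' *\<^sub>R w + \<eta>' *\<^sub>R v))"
      using second_difference_mean_value[OF f L \<open>h > 0\<close>] by blast
    let ?p = "dir_deriv w (dir_deriv v f) (x + \<xi> *\<^sub>R v + \<eta> *\<^sub>R w)"
    let ?q = "dir_deriv v (dir_deriv w f) (x + \<xi>' *\<^sub>R w + \<eta>' *\<^sub>R v)"
    have swap: "x + h *\<^sub>R w + h *\<^sub>R v = x + h *\<^sub>R v + h *\<^sub>R w" by (simp add: algebra_simps)
    have "h * h * L ?p = h * h * L ?q"
      using a(5) b(5) unfolding swap by linarith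
    then have pq: "L ?p = L ?q" using \<open>h > 0\<close> by simp
    have "\<bar>L ?p - L (dir_deriv w (dir_deriv v f) x)\<bar> < e"
      using L1[of "?p - dir_deriv w (dir_deriv v f) x"] h1(2)[of \<xi> \<eta>] a
      by (simp add: h_def linear_diff[OF bounded_linear.linear[OF L]])
    moreover have "\<bar>L ?q - L (dir_deriv v (dir_deriv w f) x)\<bar> < e"
      using L1[of "?q - dir_deriv v (dir_deriv w f) x"] h2(2)[of \<xi>' \<eta>'] b
      by (simp add: h_def linear_diff[OF bounded_linear.linear[OF L]])
    ultimately show False unfolding pq e_def by (auto simp: abs_if split: if_splits)
  qed
  from this[OF bounded_linear_Re abs_Re_le_cmod] this[OF bounded_linear_Im abs_Im_le_cmod]
  show "dir_deriv v (dir_deriv w f) x = dir_deriv w (dir_deriv v f) x"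
    by (rule complex_eqI)
qed

text \<open>Where k \<le> norm x < 1 + k, the integrand is at most the inverse of (1 + k)^(DIM + 2),
  while the ball of radius 1 + k has volume proportional to (1 + k)^DIM. The surplus 2 in the
  exponent leaves a convergent series.\<close>

lemma integrable_inverse_power:
  "integrable lborel (\<lambda>x::'a::euclidean_space. inverse ((1 + norm x) ^ (DIM('a) + 2)))"
proof (rule integrableI_bounded)
  let ?V = "unit_ball_vol (real DIM('a))"
  let ?D = "DIM('a)"
  have "(\<integral>\<^sup>+ x. ennreal (norm (inverse ((1 + norm (x::'a)) ^ (?D + 2)))) \<partial>lborel)
     \<le> (\<integral>\<^sup>+ x. (\<Sum>k. ennreal (inverse ((1 + real k) ^ (?D + 2))) * indicator (ball (0::'a) (1 + real k)) x) \<partial>lborel)"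
  proof (rule nn_integral_mono)
    fix x :: 'a
    define k where "k = nat \<lfloor>norm x\<rfloor>"
    have k: "real k \<le> norm x" "norm x < 1 + real k"
      unfolding k_def by (simp, simp only: of_nat_nat zero_le_floor norm_ge_zero, linarith)
    have "ennreal (norm (inverse ((1 + norm x) ^ (?D + 2)))) \<le> ennreal (inverse ((1 + real k) ^ (?D + 2)))"
      using k by (intro ennreal_leI) (auto intro!: le_imp_inverse_le power_mono simp del: power_Suc simp: add_pos_nonneg)
    also have "\<dots> = (\<Sum>k'\<in>{k}. ennreal (inverse ((1 + real k') ^ (?D + 2))) * indicator (ball (0::'a) (1 + real k')) x)"
      using k by (simp add: indicator_def)
    also have "\<dots> \<le> (\<Sum>k'. ennreal (inverse ((1 + real k') ^ (?D + 2))) * indicator (ball (0::'a) (1 + real k')) x)"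
      by (rule sum_le_suminf) auto
    finally show "ennreal (norm (inverse ((1 + norm x) ^ (?D + 2)))) \<le> \<dots>" .
  qed
  also have "\<dots> = (\<Sum>k. \<integral>\<^sup>+ x. ennreal (inverse ((1 + real k) ^ (?D + 2))) * indicator (ball (0::'a) (1 + real k)) x \<partial>lborel)"
    by (rule nn_integral_suminf)
       (intro borel_measurable_times_ennreal borel_measurable_const borel_measurable_indicator, simp)
  also have "\<dots> = (\<Sum>k. ennreal (?V * inverse ((1 + real k) ^ 2)))"
  proof (rule suminf_cong)
    fix k
    have "(\<integral>\<^sup>+ x. ennreal (inverse ((1 + real k) ^ (?D + 2))) * indicator (ball (0::'a) (1 + real k)) x \<partial>lborel)
       = ennreal (inverse ((1 + real k) ^ (?D + 2))) * emeasure lborel (ball (0::'a) (1 + real k))"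
      by (subst nn_integral_cmult_indicator) auto
    also have "\<dots> = ennreal (inverse ((1 + real k) ^ (?D + 2)) * (?V * (1 + real k) ^ ?D))"
      by (subst emeasure_ball) (auto simp: ennreal_mult)
    also have "inverse ((1 + real k) ^ (?D + 2)) * (?V * (1 + real k) ^ ?D) = ?V * inverse ((1 + real k) ^ 2)"
      by (simp only: power_add inverse_mult_distrib) (simp add: mult.assoc mult.left_commute[of _ ?V])
    finally show "(\<integral>\<^sup>+ x. ennreal (inverse ((1 + real k) ^ (?D + 2))) * indicator (ball (0::'a) (1 + real k)) x \<partial>lborel)
       = ennreal (?V * inverse ((1 + real k) ^ 2))" .
  qed
  also have "\<dots> < \<infinity>"
  proof -
    have "summable (\<lambda>k. inverse ((1 + real k) ^ 2))"
      using summable_Suc_iff[of "\<lambda>k. inverse (real k ^ 2)"] inverse_power_summable[of 2, where ?'a = real]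
      by simp
    then have s: "summable (\<lambda>k. ?V * inverse ((1 + real k) ^ 2))" by (rule summable_mult)
    then show ?thesis
      by (subst suminf_ennreal2) (auto simp: unit_ball_vol_nonneg)
  qed
  finally show "(\<integral>\<^sup>+ x. ennreal (norm (inverse ((1 + norm (x::'a)) ^ (?D + 2)))) \<partial>lborel) < \<infinity>" .
qed measurable

text \<open>Since (1 + r)^M \<le> 2^M (1 + r^M), the decay estimates of orders 0 and
  \<open>M\<close> together give the bound.\<close>

lemma decay_bound:
  fixes f :: "'a::real_normed_vector \<Rightarrow> complex"
  assumes "\<And>N. \<exists>C. \<forall>x. norm x ^ N * norm (f x) \<le> C"
  obtains C where "C \<ge> 0" "\<And>x. norm (f x) \<le> C * inverse ((1 + norm x) ^ M)"
proof -
  obtain A where A: "A \<ge> 0" "\<And>x. norm x ^ 0 * norm (f x) \<le> A" using decay_nonneg[OF assms] by blast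
  obtain B where B: "B \<ge> 0" "\<And>x. norm x ^ M * norm (f x) \<le> B" using decay_nonneg[OF assms] by blast
  have "norm (f x) \<le> 2 ^ M * (A + B) * inverse ((1 + norm x) ^ M)" for x
  proof -
    have "(1 + norm x) ^ M \<le> 2 ^ M * (1 + norm x ^ M)"
    proof -
      have "(1 + norm x) ^ M \<le> (2 * max 1 (norm x)) ^ M" by (intro power_mono) auto
      also have "\<dots> = 2 ^ M * max 1 (norm x) ^ M" by (simp add: power_mult_distrib)
      also have "max 1 (norm x) ^ M \<le> 1 + norm x ^ M" by (cases "norm x \<le> 1") (auto simp: max_def)
      finally show ?thesis by simp
    qed
    then have "(1 + norm x) ^ M * norm (f x) \<le> 2 ^ M * (1 + norm x ^ M) * norm (f x)"
      by (rule mult_right_mono) simp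
    also have "\<dots> = 2 ^ M * (norm x ^ 0 * norm (f x) + norm x ^ M * norm (f x))"
      by (simp add: algebra_simps)
    also have "\<dots> \<le> 2 ^ M * (A + B)" by (intro mult_left_mono add_mono A B) auto
    finally have *: "(1 + norm x) ^ M * norm (f x) \<le> 2 ^ M * (A + B)" .
    have "0 < (1 + norm x) ^ M" by (simp add: add_pos_nonneg)
    from * show ?thesis
      by (subst divide_inverse[symmetric], subst pos_le_divide_eq[OF \<open>0 < (1 + norm x) ^ M\<close>])
         (simp only: mult.commute)
  qed
  moreover have "2 ^ M * (A + B) \<ge> 0" using A B by simp
  ultimately show ?thesis using that by blast
qed

lemma integrable_decay:
  fixes f :: "'a::euclidean_space \<Rightarrow> complex"
  assumes "f \<in> borel_measurable borel"
    and "\<And>N. \<exists>C. \<forall>x. norm x ^ N * norm (f x) \<le> C"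
  shows "integrable lborel f"
proof -
  obtain C where C: "C \<ge> 0" "\<And>x. norm (f x) \<le> C * inverse ((1 + norm x) ^ (DIM('a) + 2))"
    using decay_bound[OF assms(2)] by blast
  show ?thesis
  proof (rule Bochner_Integration.integrable_bound)
    show "integrable lborel (\<lambda>x::'a. C * inverse ((1 + norm x) ^ (DIM('a) + 2)))"
      by (intro integrable_mult_right integrable_inverse_power)
    show "AE x in lborel. norm (f x) \<le> norm (C * inverse ((1 + norm x) ^ (DIM('a) + 2)))"
      using C by (auto intro: order_trans[OF _ abs_ge_self])
  qed (use assms in simp)
qed

section \<open>Integrals of Schwartz functions and of their derivatives\<close>

lemma schwartz_measurable: "schwartz f \<Longrightarrow> f \<in> borel_measurable borel"
  by (intro borel_measurable_continuous_onI schwartz_continuous)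

lemma schwartz_integrable: "schwartz f \<Longrightarrow> integrable lborel f"
  by (intro integrable_decay schwartz_measurable schwartz_decay)

lemma integral_translate:
  fixes f :: "'a::euclidean_space \<Rightarrow> complex"
  assumes "f \<in> borel_measurable borel"
  shows "(\<integral>x. f (x + a) \<partial>lborel) = (\<integral>x. f x \<partial>lborel)"
proof -
  have "(\<integral>x. f x \<partial>lborel) = (\<integral>x. f x \<partial>distr lborel borel ((+) a))"
    by (simp add: lborel_distr_plus)
  also have "\<dots> = (\<integral>x. f (a + x) \<partial>lborel)"
    using assms by (intro integral_distr) auto
  finally show ?thesis by (simp add: add.commute)
qed

text \<open>Difference quotients integrate to 0 by translation invariance and tend to the
  derivative; the mean value inequality and the decay of the derivative provide an integrable
  majorant.\<close>

lemma integral_dir_deriv: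
  assumes f: "schwartz f"
  shows "(\<integral>x. dir_deriv v f x \<partial>lborel) = 0"
proof -
  let ?M = "DIM('a heis) + 2"
  \<comment> \<open>Steps of length at most 1 keep all intermediate points within
    \<open>norm v\<close> of \<open>x\<close>.\<close>
  define h where "h = (\<lambda>n. inverse (real (Suc n)))"
  have h: "0 < h n" "h n \<le> 1" for n by (auto simp: h_def field_simps)
  define g where "g = (\<lambda>n x. (f (x + h n *\<^sub>R v) - f x) / of_real (h n))"
  obtain C where C: "C \<ge> 0" "\<And>x. norm (dir_deriv v f x) \<le> C * inverse ((1 + norm x) ^ ?M)"
    using decay_bound[OF schwartz_decay[OF schwartz_dir_deriv[OF f]]] by blast
  \<comment> \<open>The factor with \<open>norm v\<close> is the price for replacing x + s v by x,
    through 1 + norm x \<le> (1 + norm (x + s v)) (1 + norm v).\<close>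
  define w where "w = (\<lambda>x::'a heis. C * (1 + norm v) ^ ?M * inverse ((1 + norm x) ^ ?M))"
  have [measurable]: "f \<in> borel_measurable borel" using schwartz_measurable[OF f] .
  have int0: "(\<integral>x. g n x \<partial>lborel) = 0" for n
  proof -
    have i: "integrable lborel (\<lambda>x. f (x + h n *\<^sub>R v))"
    proof -
      have "integrable (distr lborel borel ((+) (h n *\<^sub>R v))) f"
        by (simp add: lborel_distr_plus schwartz_integrable[OF f])
      then show ?thesis
        by (subst (asm) integrable_distr_eq) (auto simp: add.commute)
    qed
    have "(\<integral>x. f (x + h n *\<^sub>R v) - f x \<partial>lborel) = 0"
      by (subst Bochner_Integration.integral_diff[OF i schwartz_integrable[OF f]])
         (simp add: integral_translate)
    then show ?thesis by (simp add: g_def)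
  qed
  have "(\<lambda>n. \<integral>x. g n x \<partial>lborel) \<longlonglongrightarrow> (\<integral>x. dir_deriv v f x \<partial>lborel)"
  proof (rule integral_dominated_convergence[where w = w])
    show "integrable lborel w"
      unfolding w_def by (intro integrable_mult_right integrable_inverse_power)
    show "AE x in lborel. (\<lambda>n. g n x) \<longlonglongrightarrow> dir_deriv v f x"
    proof (rule AE_I2)
      fix x
      have "((\<lambda>s. f (x + s *\<^sub>R v)) has_vector_derivative dir_deriv v f (x + 0 *\<^sub>R v)) (at 0)"
        by (rule has_vector_derivative_line[OF schwartz_differentiable[OF f]])
      then have "((\<lambda>t. norm (f (x + t *\<^sub>R v) - f x - t *\<^sub>R dir_deriv v f x) / norm t) \<longlongrightarrow> 0) (at 0)"
        by (simp add: has_vector_derivative_def has_derivative_at)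
      moreover have "eventually (\<lambda>t. norm (f (x + t *\<^sub>R v) - f x - t *\<^sub>R dir_deriv v f x) / norm t
          = norm ((f (x + t *\<^sub>R v) - f x) /\<^sub>R t - dir_deriv v f x)) (at 0)"
        unfolding eventually_at_filter
      proof (intro always_eventually allI impI)
        fix t :: real assume "t \<noteq> 0"
        then have "(f (x + t *\<^sub>R v) - f x) /\<^sub>R t - dir_deriv v f x
            = (f (x + t *\<^sub>R v) - f x - t *\<^sub>R dir_deriv v f x) /\<^sub>R t"
          by (simp add: scaleR_diff_right)
        then show "norm (f (x + t *\<^sub>R v) - f x - t *\<^sub>R dir_deriv v f x) / norm t
          = norm ((f (x + t *\<^sub>R v) - f x) /\<^sub>R t - dir_deriv v f x)"
          by (simp add: divide_inverse mult.commute)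
      qed
      ultimately have "((\<lambda>t. norm ((f (x + t *\<^sub>R v) - f x) /\<^sub>R t - dir_deriv v f x)) \<longlongrightarrow> 0) (at 0)"
        by (rule Lim_transform_eventually)
      then have lim: "((\<lambda>t. (f (x + t *\<^sub>R v) - f x) /\<^sub>R t) \<longlongrightarrow> dir_deriv v f x) (at 0)"
        by (simp only: tendsto_norm_zero_iff Lim_null[symmetric])
      have "filterlim h (at 0) sequentially"
        unfolding filterlim_at using h(1) LIMSEQ_inverse_real_of_nat
        by (auto simp: h_def)
      from filterlim_compose[OF lim this]
      show "(\<lambda>n. g n x) \<longlonglongrightarrow> dir_deriv v f x"
        by (simp add: g_def scaleR_conv_of_real divide_inverse mult.commute)
    qed
    show "AE x in lborel. norm (g n x) \<le> w x" for n
    proof (rule AE_I2)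
      fix x
      have "\<exists>s\<in>{0<..<h n}. norm (f (x + h n *\<^sub>R v) - f (x + 0 *\<^sub>R v))
           \<le> norm ((h n - 0) *\<^sub>R dir_deriv v f (x + s *\<^sub>R v))"
      proof (rule mvt_general[of 0 "h n" "\<lambda>s. f (x + s *\<^sub>R v)" "\<lambda>s t. t *\<^sub>R dir_deriv v f (x + s *\<^sub>R v)"])
        have d: "((\<lambda>s. f (x + s *\<^sub>R v)) has_vector_derivative dir_deriv v f (x + s *\<^sub>R v)) (at s)" for s
          by (rule has_vector_derivative_line[OF schwartz_differentiable[OF f]])
        show "continuous_on {0..h n} (\<lambda>s. f (x + s *\<^sub>R v))"
          by (intro continuous_at_imp_continuous_on ballI has_vector_derivative_continuous[OF d])
        show "((\<lambda>s. f (x + s *\<^sub>R v)) has_derivative (\<lambda>t. t *\<^sub>R dir_deriv v f (x + s *\<^sub>R v))) (at s)" for s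
          using d[of s] by (simp add: has_vector_derivative_def)
      qed (use h in auto)
      then obtain s where s: "0 < s" "s < h n"
        "norm (f (x + h n *\<^sub>R v) - f x) \<le> h n * norm (dir_deriv v f (x + s *\<^sub>R v))"
        using h(1)[of n] by auto
      have "norm (g n x) \<le> norm (dir_deriv v f (x + s *\<^sub>R v))"
        using s(3) h(1)[of n] by (simp add: g_def norm_divide divide_le_eq mult.commute)
      also have "\<dots> \<le> C * inverse ((1 + norm (x + s *\<^sub>R v)) ^ ?M)" by (rule C)
      also have "inverse ((1 + norm (x + s *\<^sub>R v)) ^ ?M) \<le> (1 + norm v) ^ ?M * inverse ((1 + norm x) ^ ?M)"
      proof -
        have sv: "norm (s *\<^sub>R v) \<le> norm v"
          using s h(2)[of n] mult_right_mono[of s 1 "norm v"] by simp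
        have "1 + norm x \<le> 1 + norm (x + s *\<^sub>R v) + norm v"
          using norm_triangle_ineq4[of "x + s *\<^sub>R v" "s *\<^sub>R v"] sv by simp
        also have "\<dots> \<le> (1 + norm (x + s *\<^sub>R v)) * (1 + norm v)"
          by (simp add: algebra_simps)
        finally have "(1 + norm x) ^ ?M \<le> ((1 + norm (x + s *\<^sub>R v)) * (1 + norm v)) ^ ?M"
          by (intro power_mono) auto
        then have *: "(1 + norm x) ^ ?M \<le> (1 + norm (x + s *\<^sub>R v)) ^ ?M * (1 + norm v) ^ ?M"
          by (simp only: power_mult_distrib)
        have "0 < (1 + norm x) ^ ?M" "0 < (1 + norm (x + s *\<^sub>R v)) ^ ?M"
          by (auto simp: add_pos_nonneg simp del: power_Suc)
        with * show ?thesis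
          by (simp only: divide_inverse[symmetric] inverse_eq_divide) (simp add: field_simps)
      qed
      finally show "norm (g n x) \<le> w x"
        using C(1) by (simp add: w_def mult_left_mono mult.assoc)
    qed
    show "dir_deriv v f \<in> borel_measurable lborel"
      using schwartz_measurable[OF schwartz_dir_deriv[OF f]] by simp
    show "g n \<in> borel_measurable lborel" for n
      unfolding g_def by measurable
  qed
  then show ?thesis by (simp add: int0 LIMSEQ_const_iff)
qed

section \<open>Left-invariant vector fields on Schwartz functions\<close>

definition l2_pairing :: "('n::finite heis \<Rightarrow> complex) \<Rightarrow> ('n heis \<Rightarrow> complex) \<Rightarrow> complex" where
  "l2_pairing f g = (\<integral>x. f x * cnj (g x) \<partial>lborel)"

lemma schwartz_pairing_integrable:
  "schwartz f \<Longrightarrow> schwartz g \<Longrightarrow> integrable lborel (\<lambda>x. f x * cnj (g x))"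
  by (intro schwartz_integrable schwartz_mult schwartz_cnj)

lemma l2_pairing_add_left:
  "schwartz f \<Longrightarrow> schwartz g \<Longrightarrow> schwartz h \<Longrightarrow>
    l2_pairing (\<lambda>x. f x + g x) h = l2_pairing f h + l2_pairing g h"
  by (simp add: l2_pairing_def distrib_right schwartz_pairing_integrable)

lemma l2_pairing_add_right:
  "schwartz f \<Longrightarrow> schwartz g \<Longrightarrow> schwartz h \<Longrightarrow>
    l2_pairing h (\<lambda>x. f x + g x) = l2_pairing h f + l2_pairing h g"
  by (simp add: l2_pairing_def distrib_left schwartz_pairing_integrable)

lemma l2_pairing_cmult_left: "l2_pairing (\<lambda>x. c * f x) g = c * l2_pairing f g"
  by (simp add: l2_pairing_def mult.assoc)

lemma l2_pairing_cmult_right: "l2_pairing f (\<lambda>x. c * g x) = cnj c * l2_pairing f g"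
  by (simp add: l2_pairing_def mult.left_commute)

lemma l2_pairing_dir_deriv:
  assumes "schwartz f" "schwartz g"
  shows "l2_pairing (dir_deriv v f) g = - l2_pairing f (dir_deriv v g)"
proof -
  have "dir_deriv v (\<lambda>x. f x * cnj (g x))
      = (\<lambda>x. f x * cnj (dir_deriv v g x) + dir_deriv v f x * cnj (g x))"
    using assms
    by (intro ext)
       (simp add: dir_deriv_mult dir_deriv_cnj schwartz_differentiable schwartz_cnj)
  then have "0 = (\<integral>x. f x * cnj (dir_deriv v g x) + dir_deriv v f x * cnj (g x) \<partial>lborel)"
    using integral_dir_deriv[of "\<lambda>x. f x * cnj (g x)" v] assms
    by (simp add: schwartz_mult schwartz_cnj)
  also have "\<dots> = l2_pairing f (dir_deriv v g) + l2_pairing (dir_deriv v f) g"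
    unfolding l2_pairing_def using assms
    by (intro Bochner_Integration.integral_add schwartz_pairing_integrable schwartz_dir_deriv)
  finally show ?thesis by (simp add: eq_neg_iff_add_eq_0 add.commute)
qed

lemma bounded_linear_coord: "bounded_linear (\<lambda>x::'n::finite heis. fst x $ j)"
  by (rule bounded_linear_compose[OF bounded_linear_vec_nth bounded_linear_fst])

lemma bounded_linear_cnj_coord: "bounded_linear (\<lambda>x::'n::finite heis. cnj (fst x $ j))"
  by (rule bounded_linear_compose[OF bounded_linear_cnj bounded_linear_coord])

abbreviation sqrt2 :: complex where "sqrt2 \<equiv> complex_of_real (sqrt 2)"

lemma sqrt2_sqrt2: "sqrt2 * sqrt2 = 2" "sqrt2 * (sqrt2 * c) = 2 * c"
  by (simp_all add: mult.assoc[symmetric] of_real_mult[symmetric])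

text \<open>Written as a sum of constants times derivatives, one of them with a coordinate factor,
  the field is accessible term by term to the closure, linearity and pairing rules.\<close>

lemma vfZ_eq: "vfZ j f = (\<lambda>x. sqrt2 / 2 * dir_deriv (axis j 1, 0) f x +
    (- \<i> * sqrt2 / 2 * dir_deriv (axis j \<i>, 0) f x
     + - \<i> * sqrt2 / 4 * (cnj (fst x $ j) * dir_deriv (0, 1) f x)))"
  by (rule ext) (simp add: vfZ_def d_z_def vfT_def field_simps)

lemma vfZbar_eq: "vfZbar j f = (\<lambda>x. sqrt2 / 2 * dir_deriv (axis j 1, 0) f x +
    (\<i> * sqrt2 / 2 * dir_deriv (axis j \<i>, 0) f x
     + \<i> * sqrt2 / 4 * (fst x $ j * dir_deriv (0, 1) f x)))"
  by (rule ext) (simp add: vfZbar_def d_zbar_def vfT_def field_simps)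

lemma schwartz_vfT: "schwartz f \<Longrightarrow> schwartz (vfT f)"
  unfolding vfT_def by (rule schwartz_dir_deriv)

lemma schwartz_vfZ: "schwartz f \<Longrightarrow> schwartz (vfZ j f)"
  unfolding vfZ_eq
  by (intro schwartz_add schwartz_cmult schwartz_dir_deriv
      schwartz_linear_mult[OF bounded_linear_cnj_coord])

lemma schwartz_vfZbar: "schwartz f \<Longrightarrow> schwartz (vfZbar j f)"
  unfolding vfZbar_eq
  by (intro schwartz_add schwartz_cmult schwartz_dir_deriv
      schwartz_linear_mult[OF bounded_linear_coord])

lemmas schwartz_intros = schwartz_add schwartz_cmult schwartz_dir_deriv schwartz_vfT schwartz_vfZ
  schwartz_vfZbar schwartz_linear_mult[OF bounded_linear_coord]
  schwartz_linear_mult[OF bounded_linear_cnj_coord]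

lemma vfT_add: "schwartz f \<Longrightarrow> schwartz g \<Longrightarrow> vfT (\<lambda>x. f x + g x) = (\<lambda>x. vfT f x + vfT g x)"
  by (rule ext) (simp add: vfT_def dir_deriv_add schwartz_differentiable)

lemma vfZ_add: "schwartz f \<Longrightarrow> schwartz g \<Longrightarrow> vfZ j (\<lambda>x. f x + g x) = (\<lambda>x. vfZ j f x + vfZ j g x)"
  by (rule ext) (simp add: vfZ_eq dir_deriv_add schwartz_differentiable algebra_simps)

lemma vfZbar_add:
  "schwartz f \<Longrightarrow> schwartz g \<Longrightarrow> vfZbar j (\<lambda>x. f x + g x) = (\<lambda>x. vfZbar j f x + vfZbar j g x)"
  by (rule ext) (simp add: vfZbar_eq dir_deriv_add schwartz_differentiable algebra_simps)

lemma vfT_cmult: "schwartz f \<Longrightarrow> vfT (\<lambda>x. c * f x) = (\<lambda>x. c * vfT f x)"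
  by (rule ext) (simp add: vfT_def dir_deriv_cmult schwartz_differentiable)

lemma vfZ_cmult: "schwartz f \<Longrightarrow> vfZ j (\<lambda>x. c * f x) = (\<lambda>x. c * vfZ j f x)"
  by (rule ext) (simp add: vfZ_eq dir_deriv_cmult schwartz_differentiable algebra_simps)

lemma vfZbar_cmult: "schwartz f \<Longrightarrow> vfZbar j (\<lambda>x. c * f x) = (\<lambda>x. c * vfZbar j f x)"
  by (rule ext) (simp add: vfZbar_eq dir_deriv_cmult schwartz_differentiable algebra_simps)

lemma vfT_zero: "vfT (\<lambda>x. 0) = (\<lambda>x. 0)"
  by (simp add: vfT_def dir_deriv_const)

lemma l2_pairing_vfT:
  "schwartz f \<Longrightarrow> schwartz g \<Longrightarrow> l2_pairing (vfT f) g = - l2_pairing f (vfT g)"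
  unfolding vfT_def by (rule l2_pairing_dir_deriv)

lemma dir_deriv_coord_mult:
  assumes "schwartz f"
  shows "dir_deriv v (\<lambda>x. fst x $ j * f x) x = fst x $ j * dir_deriv v f x + fst v $ j * f x"
    and "dir_deriv v (\<lambda>x. cnj (fst x $ j) * f x) x = cnj (fst x $ j) * dir_deriv v f x + cnj (fst v $ j) * f x"
  using assms
  by (simp_all add: dir_deriv_mult dir_deriv_bounded_linear schwartz_differentiable
      bounded_linear_coord bounded_linear_cnj_coord bounded_linear_imp_differentiable)

text \<open>The coefficient of \<open>T\<close> in the field does not depend on the vertical
  coordinate, so it commutes with the vertical derivative and passes conjugated to the other side of
  the pairing.\<close>

lemma l2_pairing_vfZ:
  assumes f: "schwartz f" and g: "schwartz g"
  shows "l2_pairing (vfZ j f) g = - l2_pairing f (vfZbar j g)"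
proof -
  have "l2_pairing (\<lambda>x. cnj (fst x $ j) * dir_deriv (0,1) f x) g
      = l2_pairing (dir_deriv (0,1) f) (\<lambda>x. fst x $ j * g x)"
    by (simp add: l2_pairing_def mult_ac)
  also have "\<dots> = - l2_pairing f (dir_deriv (0,1) (\<lambda>x. fst x $ j * g x))"
    by (intro l2_pairing_dir_deriv schwartz_intros f g)
  also have "dir_deriv (0,1) (\<lambda>x. fst x $ j * g x) = (\<lambda>x. fst x $ j * dir_deriv (0,1) g x)"
    by (rule ext) (simp add: dir_deriv_coord_mult g)
  finally have *: "l2_pairing (\<lambda>x. cnj (fst x $ j) * dir_deriv (0,1) f x) g
      = - l2_pairing f (\<lambda>x. fst x $ j * dir_deriv (0,1) g x)" .
  show ?thesis
    unfolding vfZ_eq vfZbar_eq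
    by (simp only: l2_pairing_add_left l2_pairing_add_right l2_pairing_cmult_left
        l2_pairing_cmult_right schwartz_intros f g * l2_pairing_dir_deriv) (simp add: algebra_simps)
qed

lemma l2_pairing_cnj: "cnj (l2_pairing f g) = l2_pairing g f"
  unfolding l2_pairing_def by (subst Bochner_Integration.integral_cnj[symmetric]) (simp add: mult.commute)

lemma l2_pairing_vfZbar:
  assumes f: "schwartz f" and g: "schwartz g"
  shows "l2_pairing (vfZbar j f) g = - l2_pairing f (vfZ j g)"
  using l2_pairing_vfZ[OF g f, of j, THEN arg_cong[of _ _ cnj]] by (simp add: l2_pairing_cnj)

text \<open>Derivatives in constant directions commute, so the extra term comes only from
  differentiating the coefficient of \<open>T\<close>. It vanishes for vertical \<open>v\<close>,
  which makes \<open>T\<close> central.\<close>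

lemma dir_deriv_vfZ:
  assumes "schwartz f"
  shows "dir_deriv v (vfZ j f) x = vfZ j (dir_deriv v f) x - \<i> * sqrt2 / 4 * cnj (fst v $ j) * vfT f x"
  unfolding vfZ_eq
  by (simp only: dir_deriv_add dir_deriv_cmult schwartz_differentiable schwartz_intros assms
      dir_deriv_coord_mult dir_deriv_commute[OF assms, of v] vfT_def) (simp add: algebra_simps)

lemma dir_deriv_vfZbar:
  assumes "schwartz f"
  shows "dir_deriv v (vfZbar j f) x = vfZbar j (dir_deriv v f) x + \<i> * sqrt2 / 4 * (fst v $ j) * vfT f x"
  unfolding vfZbar_eq
  by (simp only: dir_deriv_add dir_deriv_cmult schwartz_differentiable schwartz_intros assms
      dir_deriv_coord_mult dir_deriv_commute[OF assms, of v] vfT_def) (simp add: algebra_simps)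

lemma vfT_vfZ: "schwartz f \<Longrightarrow> vfT (vfZ j f) = vfZ j (vfT f)"
  by (rule ext) (simp add: vfT_def dir_deriv_vfZ)

lemma vfT_vfZbar: "schwartz f \<Longrightarrow> vfT (vfZbar j f) = vfZbar j (vfT f)"
  by (rule ext) (simp add: vfT_def dir_deriv_vfZbar)

text \<open>The pointwise form allows the outer field of a composition to be expanded alone, so that
  \<open>dir_deriv_vfZ\<close> and \<open>dir_deriv_vfZbar\<close> can act on the inner one. In the
  commutator proofs below, explicit instances orient the symmetry of second derivatives, which would
  loop as a general rule.\<close>

lemma vfZ_expand: "vfZ j f x = sqrt2 / 2 * dir_deriv (axis j 1, 0) f x +
    (- \<i> * sqrt2 / 2 * dir_deriv (axis j \<i>, 0) f x
     + - \<i> * sqrt2 / 4 * (cnj (fst x $ j) * dir_deriv (0, 1) f x))"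
  by (simp add: vfZ_eq)

lemma vfZbar_expand: "vfZbar j f x = sqrt2 / 2 * dir_deriv (axis j 1, 0) f x +
    (\<i> * sqrt2 / 2 * dir_deriv (axis j \<i>, 0) f x
     + \<i> * sqrt2 / 4 * (fst x $ j * dir_deriv (0, 1) f x))"
  by (simp add: vfZbar_eq)

lemma vfZ_vfZ_commute:
  assumes f: "schwartz f"
  shows "vfZ j (vfZ k f) x = vfZ k (vfZ j f) x"
  unfolding vfZ_expand[of j "vfZ k f"] vfZ_expand[of k "vfZ j f"] dir_deriv_vfZ[OF f]
  unfolding vfZ_expand vfT_def
    dir_deriv_commute[OF f, of "(axis k 1, 0)" "(axis j 1, 0)"]
    dir_deriv_commute[OF f, of "(axis k 1, 0)" "(axis j \<i>, 0)"]
    dir_deriv_commute[OF f, of "(axis k \<i>, 0)" "(axis j 1, 0)"]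
    dir_deriv_commute[OF f, of "(axis k \<i>, 0)" "(axis j \<i>, 0)"]
    dir_deriv_commute[OF f, of "(0, 1)" "(axis j 1, 0)"]
    dir_deriv_commute[OF f, of "(0, 1)" "(axis j \<i>, 0)"]
    dir_deriv_commute[OF f, of "(0, 1)" "(axis k 1, 0)"]
    dir_deriv_commute[OF f, of "(0, 1)" "(axis k \<i>, 0)"]
  by (simp add: axis_def algebra_simps)

lemma vfZbar_vfZbar_commute:
  assumes f: "schwartz f"
  shows "vfZbar j (vfZbar k f) x = vfZbar k (vfZbar j f) x"
  unfolding vfZbar_expand[of j "vfZbar k f"] vfZbar_expand[of k "vfZbar j f"] dir_deriv_vfZbar[OF f]
  unfolding vfZbar_expand vfT_def
    dir_deriv_commute[OF f, of "(axis k 1, 0)" "(axis j 1, 0)"]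
    dir_deriv_commute[OF f, of "(axis k 1, 0)" "(axis j \<i>, 0)"]
    dir_deriv_commute[OF f, of "(axis k \<i>, 0)" "(axis j 1, 0)"]
    dir_deriv_commute[OF f, of "(axis k \<i>, 0)" "(axis j \<i>, 0)"]
    dir_deriv_commute[OF f, of "(0, 1)" "(axis j 1, 0)"]
    dir_deriv_commute[OF f, of "(0, 1)" "(axis j \<i>, 0)"]
    dir_deriv_commute[OF f, of "(0, 1)" "(axis k 1, 0)"]
    dir_deriv_commute[OF f, of "(0, 1)" "(axis k \<i>, 0)"]
  by (simp add: axis_def algebra_simps)

text \<open>Once the second derivatives cancel, only derivatives of the coefficients of
  \<open>T\<close> remain. For j = k each of the two fields contributes \<i>/2 times
  \<open>T\<close>; otherwise both contributions vanish.\<close>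

lemma vfZ_vfZbar_commutator:
  assumes f: "schwartz f"
  shows "vfZ j (vfZbar k f) x = vfZbar k (vfZ j f) x + (if j = k then \<i> * vfT f x else 0)"
  unfolding vfZ_expand[of j "vfZbar k f"] vfZbar_expand[of k "vfZ j f"] dir_deriv_vfZ[OF f]
    dir_deriv_vfZbar[OF f]
  unfolding vfZ_expand vfZbar_expand vfT_def
    dir_deriv_commute[OF f, of "(axis k 1, 0)" "(axis j 1, 0)"]
    dir_deriv_commute[OF f, of "(axis k 1, 0)" "(axis j \<i>, 0)"]
    dir_deriv_commute[OF f, of "(axis k \<i>, 0)" "(axis j 1, 0)"]
    dir_deriv_commute[OF f, of "(axis k \<i>, 0)" "(axis j \<i>, 0)"]
    dir_deriv_commute[OF f, of "(0, 1)" "(axis j 1, 0)"]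
    dir_deriv_commute[OF f, of "(0, 1)" "(axis j \<i>, 0)"]
    dir_deriv_commute[OF f, of "(0, 1)" "(axis k 1, 0)"]
    dir_deriv_commute[OF f, of "(0, 1)" "(axis k \<i>, 0)"]
  by (simp add: axis_def algebra_simps sqrt2_sqrt2)

text \<open>Such a function is constant on vertical lines, along which it also tends to 0.\<close>

lemma vfT_eq_zero_imp:
  assumes f: "schwartz f" and "vfT f = (\<lambda>x. 0)"
  shows "f = (\<lambda>x. 0)"
proof
  fix x :: "'a heis"
  define F where "F = (\<lambda>s. f (x + s *\<^sub>R (0, 1)))"
  have "(F has_vector_derivative 0) (at s)" for s
    using has_vector_derivative_line[OF schwartz_differentiable[OF f], of x "(0,1)" s] assms(2)
    by (simp add: F_def vfT_def fun_eq_iff)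
  then obtain c where c: "\<And>s. F s = c"
    using has_vector_derivative_zero_constant[of UNIV F] by auto
  obtain C where C: "\<And>y. norm y ^ 1 * norm (f y) \<le> C" using schwartz_decay[OF f] by blast
  have "c = 0"
  proof (rule ccontr)
    assume "c \<noteq> 0"
    \<comment> \<open>High enough that norm (x + s (0, 1)) is at least (\<bar>C\<bar> + 1) / norm c,
      against the decay bound \<open>C\<close>.\<close>
    define s where "s = (\<bar>C\<bar> + 1) / norm c + norm x"
    have "s > 0" using \<open>c \<noteq> 0\<close> by (simp add: s_def add_pos_nonneg)
    have "norm (s *\<^sub>R (0::complex^'a, 1::real)) \<le> norm (x + s *\<^sub>R (0, 1)) + norm x"
      using norm_triangle_ineq4[of "x + s *\<^sub>R (0, 1)" x] by simp
    then have "s \<le> norm (x + s *\<^sub>R (0, 1)) + norm x" using \<open>s > 0\<close> by (simp add: norm_Pair)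
    then have "(\<bar>C\<bar> + 1) / norm c * norm c \<le> norm (x + s *\<^sub>R (0, 1)) * norm c"
      by (intro mult_right_mono) (auto simp: s_def)
    also have "\<dots> \<le> C" using C[of "x + s *\<^sub>R (0, 1)"] c[of s] by (simp add: F_def)
    finally show False using \<open>c \<noteq> 0\<close> by simp
  qed
  then show "f x = 0" using c[of 0] by (simp add: F_def zero_prod_def[symmetric])
qed

text \<open>The zero set is closed and has full measure, hence is the whole space.\<close>

lemma continuous_nonneg_integral_zero:
  fixes f :: "'a::euclidean_space \<Rightarrow> real"
  assumes "continuous_on UNIV f" "\<And>x. f x \<ge> 0" "integrable lborel f" "(\<integral>x. f x \<partial>lborel) = 0"
  shows "f x = 0"
proof -
  have "AE x in lborel. f x = 0"
    using integral_nonneg_eq_0_iff_AE[OF assms(3)] assms by simp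
  then have "AE x in lebesgue. f x = 0" by (rule AE_completion)
  moreover have "closed {x. f x = 0}"
    using continuous_closed_preimage_constant[of UNIV f 0] assms(1) by simp
  ultimately show ?thesis
    using mem_closed_if_AE_lebesgue[of "{x. f x = 0}" x] by simp
qed

section \<open>Exterior algebra in the coframe\<close>

text \<open>The antiderivation rule for contraction. The first slot holds a vector field instead of
  a fixed vector because the horizontal frame depends on the base point.\<close>

lemma wedge_Cons:
  "wedge \<alpha> \<omega> x (V x # vs) = \<alpha> x (V x) * \<omega> x vs - wedge \<alpha> (\<lambda>y ws. \<omega> y (V y # ws)) x vs"
  by (simp add: wedge_def sum.lessThan_Suc_shift sum_negf[symmetric] del: sum.lessThan_Suc)

lemma wedge_Nil: "wedge \<alpha> \<omega> x [] = 0"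
  by (simp add: wedge_def)

lemma wedge_cmult: "wedge \<alpha> (\<lambda>x vs. c x * \<omega> x vs) x vs = c x * wedge \<alpha> \<omega> x vs"
  by (simp add: wedge_def sum_distrib_left mult_ac)

lemma wedge_diff:
  "wedge \<alpha> (\<lambda>x vs. \<omega> x vs - \<eta> x vs) x vs = wedge \<alpha> \<omega> x vs - wedge \<alpha> \<eta> x vs"
  by (simp add: wedge_def sum_subtractf algebra_simps)

lemma wedge_zero: "wedge \<alpha> (\<lambda>x vs. 0) x vs = 0"
  by (simp add: wedge_def)

lemma wedge_sum: "wedge \<alpha> (\<lambda>x vs. \<Sum>i\<in>I. \<omega> i x vs) x vs = (\<Sum>i\<in>I. wedge \<alpha> (\<omega> i) x vs)"
  unfolding wedge_def sum_distrib_left by (rule sum.swap)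

lemma wedge_sum_left: "wedge (\<lambda>x v. \<Sum>i\<in>I. \<alpha> i x v) \<omega> x vs = (\<Sum>i\<in>I. wedge (\<alpha> i) \<omega> x vs)"
  unfolding wedge_def sum_distrib_left sum_distrib_right by (rule sum.swap)

lemma wedge_add_left:
  "wedge (\<lambda>x v. \<alpha> x v + \<beta> x v) \<omega> x vs = wedge \<alpha> \<omega> x vs + wedge \<beta> \<omega> x vs"
  by (simp add: wedge_def sum.distrib algebra_simps)

lemma wedge_cmult_left: "wedge (\<lambda>x v. c x * \<alpha> x v) \<omega> x vs = c x * wedge \<alpha> \<omega> x vs"
  by (simp add: wedge_def sum_distrib_left mult_ac)

lemma wedge_anticommute: "wedge \<alpha> (wedge \<beta> \<omega>) x vs = - wedge \<beta> (wedge \<alpha> \<omega>) x vs"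
proof (induction vs arbitrary: \<omega>)
  case Nil
  then show ?case by (simp add: wedge_Nil)
next
  case (Cons v vs)
  show ?case
    by (simp add: wedge_Cons[where V = "\<lambda>_. v"] wedge_diff wedge_cmult Cons.IH)
qed

text \<open>Names for the coframe elements, so that the exterior algebra is developed once for all
  three kinds.\<close>

datatype 'n gen = Th | Ze 'n | Zb 'n

primrec gform :: "'n::finite gen \<Rightarrow> 'n heis \<Rightarrow> 'n heis \<Rightarrow> complex" where
  "gform Th = theta"
| "gform (Ze j) = zeta j"
| "gform (Zb j) = zetabar j"

text \<open>The real left-invariant horizontal fields; the vertical components here and in
  \<open>horiz_y\<close> are those that put the vectors into the kernel of
  \<open>theta\<close>.\<close>

definition horiz_x :: "'n \<Rightarrow> 'n::finite heis \<Rightarrow> 'n heis" where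
  "horiz_x j x = (axis j 1, - Im (fst x $ j) / 2)"

definition horiz_y :: "'n \<Rightarrow> 'n::finite heis \<Rightarrow> 'n heis" where
  "horiz_y j x = (axis j \<i>, Re (fst x $ j) / 2)"

text \<open>Contraction with the complex vector field dual to a generator of the coframe, written as a
  combination of contractions with real vector fields.\<close>

primrec contract :: "'n gen \<Rightarrow> 'n::finite form \<Rightarrow> 'n form" where
  "contract Th \<omega> = (\<lambda>x vs. \<omega> x ((0, 1) # vs))"
| "contract (Ze j) \<omega> = (\<lambda>x vs. sqrt2 / 2 * (\<omega> x (horiz_x j x # vs) - \<i> * \<omega> x (horiz_y j x # vs)))"
| "contract (Zb j) \<omega> = (\<lambda>x vs. sqrt2 / 2 * (\<omega> x (horiz_x j x # vs) + \<i> * \<omega> x (horiz_y j x # vs)))"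

lemma theta_horizontal:
  "theta x (horiz_x j x) = 0" "theta x (horiz_y j x) = 0"
proof -
  have "(\<Sum>k\<in>UNIV. cnj (fst x $ k) * (axis j c $ k) - fst x $ k * cnj (axis j c $ k))
      = cnj (fst x $ j) * c - fst x $ j * cnj c" for c
  proof -
    have "(\<Sum>k\<in>UNIV. cnj (fst x $ k) * (axis j c $ k) - fst x $ k * cnj (axis j c $ k))
       = (\<Sum>k\<in>UNIV. if k = j then cnj (fst x $ j) * c - fst x $ j * cnj c else 0)"
      by (intro sum.cong) (auto simp: axis_def)
    then show ?thesis by simp
  qed
  then show "theta x (horiz_x j x) = 0" "theta x (horiz_y j x) = 0"
    by (auto simp: horiz_x_def horiz_y_def theta_def complex_eq_iff)
qed

lemma zeta_horizontal:
  "zeta k x (horiz_x j x) = (if j = k then 1 / sqrt2 else 0)"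
  "zeta k x (horiz_y j x) = (if j = k then \<i> / sqrt2 else 0)"
  "zetabar k x (horiz_x j x) = (if j = k then 1 / sqrt2 else 0)"
  "zetabar k x (horiz_y j x) = (if j = k then - \<i> / sqrt2 else 0)"
  by (auto simp: zeta_def zetabar_def horiz_x_def horiz_y_def axis_def)

lemma gform_vertical: "zeta k x (0, 1) = 0" "zetabar k x (0, 1) = 0" "theta x (0, 1) = 1"
  by (auto simp: zeta_def zetabar_def theta_def)

text \<open>The antiderivation rule combined with the duality of frame and coframe: a canonical
  anticommutation relation.\<close>

lemma contract_wedge:
  "contract a (wedge (gform b) \<omega>) x vs
    = (if a = b then \<omega> x vs else 0) - wedge (gform b) (contract a \<omega>) x vs"
proof -
  have w: "wedge \<alpha> (\<lambda>x vs. c * (\<omega> x (V x # vs) + d * \<omega> x (W x # vs))) x vs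
     = c * (wedge \<alpha> (\<lambda>x vs. \<omega> x (V x # vs)) x vs + d * wedge \<alpha> (\<lambda>x vs. \<omega> x (W x # vs)) x vs)"
    for \<alpha> c d V W
    by (simp add: wedge_def sum_distrib_left sum.distrib[symmetric] algebra_simps)
  show ?thesis
  proof (cases a)
    case Th
    then show ?thesis
      by (cases b) (simp_all add: wedge_Cons[of _ \<omega> x "\<lambda>_. (0, 1)" vs] gform_vertical)
  next
    case (Ze j)
    then show ?thesis
      using w[of "gform b" "sqrt2 / 2" "horiz_x j" "- \<i>" "horiz_y j"]
      by (cases b) (simp_all add: wedge_Cons[of _ \<omega> x "horiz_x j" vs] wedge_Cons[of _ \<omega> x "horiz_y j" vs]
          zeta_horizontal theta_horizontal right_diff_distrib distrib_left, auto simp: field_simps)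
  next
    case (Zb j)
    then show ?thesis
      using w[of "gform b" "sqrt2 / 2" "horiz_x j" "\<i>" "horiz_y j"]
      by (cases b) (simp_all add: wedge_Cons[of _ \<omega> x "horiz_x j" vs] wedge_Cons[of _ \<omega> x "horiz_y j" vs]
          zeta_horizontal theta_horizontal right_diff_distrib distrib_left, auto simp: field_simps)
  qed
qed

definition gprod :: "'n::finite gen list \<Rightarrow> 'n form" where
  "gprod as = foldr wedge (map gform as) (\<lambda>x vs. if vs = [] then 1 else 0)"

lemma gprod_Cons: "gprod (a # as) = wedge (gform a) (gprod as)"
  by (simp add: gprod_def)

lemma gprod_move:
  "\<exists>s\<in>{1, -1}. gprod (as @ a # bs) = (\<lambda>x vs. s * gprod (a # as @ bs) x vs)"
proof (induction as)
  case Nil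
  then show ?case by auto
next
  case (Cons b as)
  then obtain s where s: "s \<in> {1, -1}" "gprod (as @ a # bs) = (\<lambda>x vs. s * gprod (a # as @ bs) x vs)"
    by blast
  have "gprod ((b # as) @ a # bs) = (\<lambda>x vs. - s * gprod (a # (b # as) @ bs) x vs)"
    by (intro ext) (simp add: gprod_Cons s(2) wedge_cmult wedge_anticommute[of "gform b"])
  moreover have "- s \<in> {1, -1}" using s(1) by auto
  ultimately show ?case by blast
qed

lemma gprod_permute:
  "mset as = mset bs \<Longrightarrow> \<exists>s\<in>{1, -1}. gprod as = (\<lambda>x vs. s * gprod bs x vs)"
proof (induction as arbitrary: bs)
  case Nil
  then show ?case by auto
next
  case (Cons a as)
  then have "a \<in> set bs" by (metis list.set_intros(1) mset_eq_setD)
  then obtain us ws where bs: "bs = us @ a # ws" by (meson split_list)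
  with Cons.prems have "mset as = mset (us @ ws)" by simp
  with Cons.IH obtain s where s: "s \<in> {1, -1}" "gprod as = (\<lambda>x vs. s * gprod (us @ ws) x vs)"
    by blast
  obtain t where t: "t \<in> {1, -1}" "gprod bs = (\<lambda>x vs. t * gprod (a # us @ ws) x vs)"
    using gprod_move bs by blast
  have "gprod (a # as) = (\<lambda>x vs. s * t * gprod bs x vs)"
    using t(1) by (intro ext) (auto simp: gprod_Cons s(2) t(2) wedge_cmult)
  moreover have "s * t \<in> {1, -1}" using s(1) t(1) by auto
  ultimately show ?case by blast
qed

lemma contract_gprod: "a \<notin> set as \<Longrightarrow> contract a (gprod as) x vs = 0"
proof (induction as arbitrary: x vs)
  case Nil
  then show ?case by (cases a) (auto simp: gprod_def)
next
  case (Cons b as)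
  then have "contract a (gprod as) = (\<lambda>x vs. 0)" by (intro ext) simp
  then show ?case using Cons.prems by (simp add: gprod_Cons contract_wedge wedge_zero)
qed

section \<open>Basis indices as sets of coframe generators\<close>

fun glist :: "'n::{finite,linorder} findex \<Rightarrow> 'n gen list" where
  "glist (I, J, b) = (if b then [Th] else []) @ map Ze (sorted_list_of_set I) @ map Zb (sorted_list_of_set J)"

fun gmem :: "'n gen \<Rightarrow> 'n findex \<Rightarrow> bool" where
  "gmem Th (I, J, b) = b"
| "gmem (Ze j) (I, J, b) = (j \<in> I)"
| "gmem (Zb j) (I, J, b) = (j \<in> J)"

fun gins :: "'n gen \<Rightarrow> 'n findex \<Rightarrow> 'n findex" where
  "gins Th (I, J, b) = (I, J, True)"
| "gins (Ze j) (I, J, b) = (insert j I, J, b)"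
| "gins (Zb j) (I, J, b) = (I, insert j J, b)"

fun grem :: "'n gen \<Rightarrow> 'n findex \<Rightarrow> 'n findex" where
  "grem Th (I, J, b) = (I, J, False)"
| "grem (Ze j) (I, J, b) = (I - {j}, J, b)"
| "grem (Zb j) (I, J, b) = (I, J - {j}, b)"

lemma basis_form_gprod: "basis_form A = gprod (glist A)"
  by (cases A) (simp add: gprod_def comp_def)

lemma gmem_glist: "gmem a A \<longleftrightarrow> a \<in> set (glist A)"
  by (cases A; cases a) auto

lemma gmem_gins: "gmem a (gins b A) \<longleftrightarrow> a = b \<or> gmem a A"
  by (cases A; cases a; cases b) auto

lemma gmem_grem: "gmem a (grem b A) \<longleftrightarrow> a \<noteq> b \<and> gmem a A"
  by (cases A; cases a; cases b) auto

lemma gins_grem: "gmem a A \<Longrightarrow> gins a (grem a A) = A"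
  by (cases A; cases a) auto

lemma grem_gins: "\<not> gmem a A \<Longrightarrow> grem a (gins a A) = A"
  by (cases A; cases a) auto

lemma mset_glist_gins: "\<not> gmem a A \<Longrightarrow> mset (glist (gins a A)) = add_mset a (mset (glist A))"
  by (cases A; cases a) auto

text \<open>This is a permutation parity, chosen by \<open>SOME\<close> since its value is never
  computed: later arguments use only that it is real with square 1 and that it relates the two
  forms.\<close>

definition gsign :: "'n gen \<Rightarrow> 'n::{finite,linorder} findex \<Rightarrow> complex" where
  "gsign a A = (SOME s. s \<in> {1, -1} \<and>
     wedge (gform a) (basis_form A) = (\<lambda>x vs. s * basis_form (gins a A) x vs))"

lemma gsign:
  assumes "\<not> gmem a A"
  shows "gsign a A \<in> {1, -1}"
    and "wedge (gform a) (basis_form A) = (\<lambda>x vs. gsign a A * basis_form (gins a A) x vs)"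
proof -
  obtain s where "s \<in> {1, -1}" "gprod (a # glist A) = (\<lambda>x vs. s * gprod (glist (gins a A)) x vs)"
    using gprod_permute[of "a # glist A" "glist (gins a A)"] mset_glist_gins[OF assms]
    by (metis mset.simps(2))
  then have "\<exists>s. s \<in> {1, -1} \<and>
     wedge (gform a) (basis_form A) = (\<lambda>x vs. s * basis_form (gins a A) x vs)"
    by (auto simp: basis_form_gprod gprod_Cons)
  from someI_ex[OF this] show "gsign a A \<in> {1, -1}"
    and "wedge (gform a) (basis_form A) = (\<lambda>x vs. gsign a A * basis_form (gins a A) x vs)"
    unfolding gsign_def[symmetric] by blast+
qed

lemma gsign_sq: "\<not> gmem a A \<Longrightarrow> gsign a A * gsign a A = 1"
  using gsign(1)[of a A] by auto

lemma cnj_gsign: "\<not> gmem a A \<Longrightarrow> cnj (gsign a A) = gsign a A"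
  using gsign(1)[of a A] by auto

lemma basis_form_gmem:
  assumes "gmem a A"
  shows "basis_form A = (\<lambda>x vs. gsign a (grem a A) * wedge (gform a) (basis_form (grem a A)) x vs)"
proof -
  have n: "\<not> gmem a (grem a A)" by (simp add: gmem_grem)
  show ?thesis
    by (simp only: gsign(2)[OF n] gins_grem[OF assms] mult.assoc[symmetric] gsign_sq[OF n] mult_1)
qed

lemma wedge_basis_form_gmem:
  assumes "gmem a A"
  shows "wedge (gform a) (basis_form A) x vs = 0"
  using wedge_anticommute[of "gform a" "gform a" "basis_form (grem a A)" x vs]
  by (subst basis_form_gmem[OF assms]) (simp add: wedge_cmult)

lemma contract_basis_form: "\<not> gmem a A \<Longrightarrow> contract a (basis_form A) x vs = 0"
  by (simp add: basis_form_gprod gmem_glist contract_gprod)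

lemma contract_cmult: "contract a (\<lambda>x vs. c x * \<omega> x vs) x vs = c x * contract a \<omega> x vs"
  by (cases a) (simp_all add: algebra_simps)

lemma contract_sum: "contract a (\<lambda>x vs. \<Sum>i\<in>I. \<omega> i x vs) x vs = (\<Sum>i\<in>I. contract a (\<omega> i) x vs)"
  by (cases a) (simp_all add: sum_distrib_left sum_subtractf sum.distrib algebra_simps)

lemma contract_basis_form_gmem:
  assumes "gmem a A"
  shows "contract a (basis_form A) x vs = gsign a (grem a A) * basis_form (grem a A) x vs"
proof -
  have n: "\<not> gmem a (grem a A)" by (simp add: gmem_grem)
  then have "contract a (basis_form (grem a A)) = (\<lambda>x vs. 0)"
    by (intro ext) (rule contract_basis_form)
  then show ?thesis
    by (subst basis_form_gmem[OF assms])
       (simp add: contract_cmult contract_wedge wedge_zero)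
qed

text \<open>The creation operator on coefficients: a basis form containing \<open>a\<close> receives
  its coefficient from the index without \<open>a\<close>.\<close>

definition eps :: "'n gen \<Rightarrow> ('n::{finite,linorder} findex \<Rightarrow> 'n heis \<Rightarrow> complex) \<Rightarrow> 'n findex \<Rightarrow> 'n heis \<Rightarrow> complex" where
  "eps a c A = (\<lambda>x. if gmem a A then gsign a (grem a A) * c (grem a A) x else 0)"

text \<open>The annihilation operator, whose matrix is the transpose of that of
  \<open>eps a\<close>.\<close>

definition iota :: "'n gen \<Rightarrow> ('n::{finite,linorder} findex \<Rightarrow> 'n heis \<Rightarrow> complex) \<Rightarrow> 'n findex \<Rightarrow> 'n heis \<Rightarrow> complex" where
  "iota a c A = (\<lambda>x. if gmem a A then 0 else gsign a A * c (gins a A) x)"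

lemma wedge_form_of: "wedge (gform a) (form_of c) = form_of (eps a c)"
proof (intro ext)
  fix x vs
  have "wedge (gform a) (form_of c) x vs = (\<Sum>A\<in>UNIV. c A x * wedge (gform a) (basis_form A) x vs)"
    unfolding form_of_def wedge_sum wedge_cmult ..
  also have "\<dots> = (\<Sum>A | \<not> gmem a A. c A x * wedge (gform a) (basis_form A) x vs)"
    by (rule sum.mono_neutral_right) (auto simp: wedge_basis_form_gmem)
  also have "\<dots> = (\<Sum>A | gmem a A. eps a c A x * basis_form A x vs)"
    by (rule sum.reindex_bij_witness[of _ "grem a" "gins a"])
       (auto simp: gmem_gins gmem_grem gins_grem grem_gins gsign(2) eps_def)
  also have "\<dots> = form_of (eps a c) x vs"
    unfolding form_of_def by (rule sum.mono_neutral_left) (auto simp: eps_def)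
  finally show "wedge (gform a) (form_of c) x vs = form_of (eps a c) x vs" .
qed

lemma contract_form_of: "contract a (form_of c) = form_of (iota a c)"
proof (intro ext)
  fix x vs
  have "contract a (form_of c) x vs = (\<Sum>A\<in>UNIV. c A x * contract a (basis_form A) x vs)"
    unfolding form_of_def contract_sum contract_cmult ..
  also have "\<dots> = (\<Sum>A | gmem a A. c A x * contract a (basis_form A) x vs)"
    by (rule sum.mono_neutral_right) (auto simp: contract_basis_form)
  also have "\<dots> = (\<Sum>A | \<not> gmem a A. iota a c A x * basis_form A x vs)"
    by (rule sum.reindex_bij_witness[of _ "gins a" "grem a"])
       (auto simp: gmem_gins gmem_grem gins_grem grem_gins contract_basis_form_gmem iota_def)
  also have "\<dots> = form_of (iota a c) x vs"
    unfolding form_of_def by (rule sum.mono_neutral_left) (auto simp: iota_def)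
  finally show "contract a (form_of c) x vs = form_of (iota a c) x vs" .
qed

text \<open>Contracting with a generator in \<open>A\<close> isolates, up to sign, the coefficient of \<open>A\<close> at a smaller index.\<close>

lemma form_of_eq_zero:
  assumes "form_of c = (\<lambda>x vs. 0)"
  shows "c A x = 0"
  using assms
proof (induction "length (glist A)" arbitrary: A c rule: less_induct)
  case less
  show ?case
  proof (cases "glist A")
    case Nil
    \<comment> \<open>On the empty list of vectors every basis form except the empty product
      vanishes.\<close>
    have "0 = form_of c x []" using less.prems by simp
    also have "\<dots> = (\<Sum>B\<in>UNIV. if B = A then c A x else 0)"
      unfolding form_of_def
    proof (rule sum.cong)
      fix B :: "'a findex"
      show "c B x * basis_form B x [] = (if B = A then c A x else 0)"
      proof (cases "glist B")
        case Nil': Nil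
        then have "B = A" using Nil by (cases A; cases B) (auto split: if_splits)
        then show ?thesis using Nil' by (simp add: basis_form_gprod gprod_def)
      next
        case (Cons a as)
        then show ?thesis using Nil by (auto simp: basis_form_gprod gprod_Cons wedge_Nil)
      qed
    qed simp
    finally show ?thesis by simp
  next
    case (Cons a as)
    then have a: "gmem a A" by (simp add: gmem_glist)
    have n: "\<not> gmem a (grem a A)" by (simp add: gmem_grem)
    have "length (glist A) = Suc (length (glist (grem a A)))"
      using mset_glist_gins[OF n] a by (metis gins_grem size_add_mset size_mset)
    moreover have "form_of (iota a c) = (\<lambda>x vs. 0)"
      unfolding contract_form_of[symmetric] less.prems by (cases a) auto
    ultimately have "iota a c (grem a A) x = 0" by (intro less.hyps) auto
    then show ?thesis using n gsign(1)[OF n] a by (auto simp: iota_def gins_grem)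
  qed
qed

lemma form_of_diff: "form_of (\<lambda>A x. c A x - d A x) = (\<lambda>x vs. form_of c x vs - form_of d x vs)"
  by (simp add: form_of_def sum_subtractf algebra_simps)

lemma form_of_inject: "form_of c = form_of d \<longleftrightarrow> c = d"
proof
  assume "form_of c = form_of d"
  then have "form_of (\<lambda>A x. c A x - d A x) = (\<lambda>x vs. 0)" by (simp add: form_of_diff)
  from form_of_eq_zero[OF this] show "c = d" by (intro ext) simp
qed simp

lemma coeffs_form_of: "coeffs (form_of c) = c"
  by (simp add: coeffs_def form_of_inject)

lemma form_of_sum: "form_of (\<lambda>A x. \<Sum>i\<in>I. c i A x) = (\<lambda>x vs. \<Sum>i\<in>I. form_of (c i) x vs)"
  unfolding form_of_def sum_distrib_right by (intro ext) (rule sum.swap)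

lemma form_of_add: "form_of (\<lambda>A x. c A x + d A x) = (\<lambda>x vs. form_of c x vs + form_of d x vs)"
  by (simp add: form_of_def sum.distrib algebra_simps)

lemma form_of_cmult: "form_of (\<lambda>A x. c * d A x) = (\<lambda>x vs. c * form_of d x vs)"
  by (simp add: form_of_def sum_distrib_left mult.assoc)

lemma form_of_zero: "form_of (\<lambda>A x. 0) = (\<lambda>x vs. 0)"
  by (simp add: form_of_def)

text \<open>As the signs are unspecified, the relation is transported from forms to coefficients by
  uniqueness of coefficients.\<close>

lemma eps_anticommute: "eps a (eps b c) A x = - eps b (eps a c) A x"
proof -
  have "form_of (eps a (eps b c)) = form_of (\<lambda>A x. (-1) * eps b (eps a c) A x)"
    unfolding form_of_cmult unfolding wedge_form_of[symmetric]
    by (intro ext) (simp add: wedge_anticommute[of "gform a"])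
  then show ?thesis unfolding form_of_inject by (simp add: fun_eq_iff)
qed

lemma iota_eps: "iota a (eps b c) A x = (if a = b then c A x else 0) - eps b (iota a c) A x"
proof -
  have "form_of (iota a (eps b c)) = form_of (\<lambda>A x. (if a = b then 1 else 0) * c A x - eps b (iota a c) A x)"
    unfolding form_of_diff form_of_cmult
    unfolding wedge_form_of[symmetric] contract_form_of[symmetric]
    by (intro ext) (simp add: contract_wedge)
  then show ?thesis unfolding form_of_inject by (simp add: fun_eq_iff)
qed

lemma eps_iota_adjoint:
  "(\<Sum>A\<in>UNIV. eps a c A x * d A x) = (\<Sum>A\<in>UNIV. c A x * iota a d A x)"
proof -
  have "(\<Sum>A\<in>UNIV. eps a c A x * d A x) = (\<Sum>A | gmem a A. eps a c A x * d A x)"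
    by (rule sum.mono_neutral_right) (simp_all add: eps_def)
  also have "\<dots> = (\<Sum>A | \<not> gmem a A. c A x * iota a d A x)"
    by (rule sum.reindex_bij_witness[of _ "gins a" "grem a"])
       (simp_all add: gmem_gins gmem_grem gins_grem grem_gins iota_def eps_def)
  also have "\<dots> = (\<Sum>A\<in>UNIV. c A x * iota a d A x)"
    by (rule sum.mono_neutral_left) (simp_all add: iota_def)
  finally show ?thesis .
qed

text \<open>The transpose of \<open>eps_anticommute\<close>: pairing with the coefficient family
  \<open>e\<close> concentrated at \<open>A\<close> reads off a single coefficient.\<close>

lemma iota_anticommute: "iota a (iota b c) A x = - iota b (iota a c) A x"
proof -
  define e where "e = (\<lambda>B (y::'a heis). if B = A then 1 else (0::complex))"
  have e: "(\<Sum>B\<in>UNIV. e B x * d B x) = d A x" for d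
    by (simp add: e_def if_distrib[of "\<lambda>z. z * _"] cong: if_cong)
  have adj: "(\<Sum>B\<in>UNIV. eps b (eps a e) B x * c B x) = iota a (iota b c) A x" for a b
    by (simp only: eps_iota_adjoint e)
  have "iota a (iota b c) A x = (\<Sum>B\<in>UNIV. eps b (eps a e) B x * c B x)"
    by (simp add: adj)
  also have "\<dots> = - (\<Sum>B\<in>UNIV. eps a (eps b e) B x * c B x)"
    unfolding eps_anticommute[of b a] by (simp add: sum_negf)
  also have "\<dots> = - iota b (iota a c) A x" by (simp add: adj)
  finally show ?thesis .
qed

section \<open>The differential of a function, and of \<open>theta\<close>, in the coframe\<close>

lemma vector_expansion:
  fixes v :: "'n::finite heis"
  shows "v = (\<Sum>j\<in>UNIV. Re (fst v $ j) *\<^sub>R (axis j 1, 0) + Im (fst v $ j) *\<^sub>R (axis j \<i>, 0)) + snd v *\<^sub>R (0, 1)"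
proof (rule prod_eqI)
  have "fst v $ k = (\<Sum>j\<in>UNIV. Re (fst v $ j) *\<^sub>R (axis j 1 $ k) + Im (fst v $ j) *\<^sub>R (axis j \<i> $ k))" for k
  proof -
    have "(\<Sum>j\<in>UNIV. Re (fst v $ j) *\<^sub>R (axis j 1 $ k) + Im (fst v $ j) *\<^sub>R (axis j \<i> $ k))
      = (\<Sum>j\<in>UNIV. if j = k then fst v $ k else 0)"
      by (intro sum.cong) (auto simp: axis_def complex_eq_iff)
    then show ?thesis by simp
  qed
  from this[symmetric] show "fst v = fst ((\<Sum>j\<in>UNIV. Re (fst v $ j) *\<^sub>R (axis j 1, 0) + Im (fst v $ j) *\<^sub>R (axis j \<i>, 0)) + snd v *\<^sub>R (0, 1))"
    by (simp add: vec_eq_iff fst_sum)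
qed (simp add: snd_sum)

text \<open>The \<open>T\<close>-terms hidden in the horizontal fields cancel against the part of
  \<open>theta\<close> that depends on the base point.\<close>

lemma dir_deriv_frame:
  assumes "f differentiable at x"
  shows "dir_deriv v f x = (\<Sum>j\<in>UNIV. vfZ j f x * zeta j x v) + (\<Sum>j\<in>UNIV. vfZbar j f x * zetabar j x v)
    + vfT f x * theta x v"
proof -
  let ?D = "\<lambda>v. dir_deriv v f x"
  note lin = dir_deriv_linear[OF assms]
  have lhs: "?D v = (\<Sum>j\<in>UNIV. Re (fst v $ j) *\<^sub>R ?D (axis j 1, 0) + Im (fst v $ j) *\<^sub>R ?D (axis j \<i>, 0)) + snd v *\<^sub>R ?D (0, 1)"
    by (subst vector_expansion) (simp only: linear_add[OF lin] linear_sum[OF lin] linear_cmul[OF lin])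
  have frame: "(\<Sum>j\<in>UNIV. vfZ j f x * zeta j x v) + (\<Sum>j\<in>UNIV. vfZbar j f x * zetabar j x v)
    = (\<Sum>j\<in>UNIV. Re (fst v $ j) *\<^sub>R ?D (axis j 1, 0) + Im (fst v $ j) *\<^sub>R ?D (axis j \<i>, 0))
      - (\<Sum>j\<in>UNIV. \<i> / 4 * (cnj (fst x $ j) * (fst v $ j) - (fst x $ j) * cnj (fst v $ j)) * ?D (0, 1))"
    unfolding sum.distrib[symmetric] sum_subtractf[symmetric]
  proof (rule sum.cong)
    fix j
    show "vfZ j f x * zeta j x v + vfZbar j f x * zetabar j x v
      = Re (fst v $ j) *\<^sub>R ?D (axis j 1, 0) + Im (fst v $ j) *\<^sub>R ?D (axis j \<i>, 0)
        - \<i> / 4 * (cnj (fst x $ j) * (fst v $ j) - (fst x $ j) * cnj (fst v $ j)) * ?D (0, 1)"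
    proof -
      have re_im: "Re u *\<^sub>R a + Im u *\<^sub>R b = u * (a - \<i> * b) / 2 + cnj u * (a + \<i> * b) / 2"
        for u a b :: complex
        by (simp add: complex_eq_iff field_simps)
      have Z: "vfZ j f x * zeta j x v
          = ((?D (axis j 1, 0) - \<i> * ?D (axis j \<i>, 0)) / 2 - \<i> / 4 * cnj (fst x $ j) * ?D (0, 1)) * (fst v $ j)"
        by (simp add: vfZ_def d_z_def vfT_def zeta_def)
      have Zbar: "vfZbar j f x * zetabar j x v
          = ((?D (axis j 1, 0) + \<i> * ?D (axis j \<i>, 0)) / 2 + \<i> / 4 * (fst x $ j) * ?D (0, 1)) * cnj (fst v $ j)"
        by (simp add: vfZbar_def d_zbar_def vfT_def zetabar_def)
      show ?thesis unfolding Z Zbar re_im by (simp add: field_simps)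
    qed
  qed simp
  have vert: "vfT f x * theta x v = snd v *\<^sub>R ?D (0, 1)
      + (\<Sum>j\<in>UNIV. \<i> / 4 * (cnj (fst x $ j) * (fst v $ j) - (fst x $ j) * cnj (fst v $ j)) * ?D (0, 1))"
    unfolding theta_def vfT_def scaleR_conv_of_real sum_distrib_right[symmetric] sum_distrib_left[symmetric]
    by (simp only: distrib_left mult.commute[of "?D (0, 1)"])
  have "P + T = (P - S) + (T + S)" for P S T :: complex by simp
  then show ?thesis unfolding lhs frame vert .
qed

lemma ext_d_Cons:
  "ext_d \<omega> x (v # vs) = dir_deriv v (\<lambda>y. \<omega> y vs) x - ext_d (\<lambda>y ws. \<omega> y (v # ws)) x vs"
  by (simp add: ext_d_def sum.lessThan_Suc_shift sum_negf[symmetric] del: sum.lessThan_Suc)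

text \<open>Despite its name this is only half the exterior derivative of \<open>theta\<close>: it
  differentiates the coefficients of \<open>theta\<close> along \<open>v\<close> and evaluates at
  \<open>w\<close>. Antisymmetrization happens in \<open>dtheta_frame\<close>.\<close>

definition dtheta :: "'n::finite heis \<Rightarrow> 'n heis \<Rightarrow> complex" where
  "dtheta v w = \<i> / 4 * (\<Sum>j\<in>UNIV. cnj (fst v $ j) * (fst w $ j) - (fst v $ j) * cnj (fst w $ j))"

lemma theta_has_derivative: "((\<lambda>y. theta y w) has_derivative (\<lambda>v. dtheta v w)) (at x)"
proof -
  have "bounded_linear (\<lambda>v. dtheta v w)"
    unfolding dtheta_def
    by (intro bounded_linear_const_mult bounded_linear_sum bounded_linear_sub bounded_linear_mult_const
        bounded_linear_coord bounded_linear_cnj_coord)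
  from has_derivative_add[OF has_derivative_const bounded_linear_imp_has_derivative[OF this]]
  show ?thesis by (simp add: theta_def dtheta_def)
qed

lemma dir_deriv_theta: "dir_deriv v (\<lambda>y. theta y w) x = dtheta v w"
  by (rule dir_deriv_eq[OF theta_has_derivative])

lemma theta_differentiable: "(\<lambda>y. theta y w) differentiable at x"
  using theta_has_derivative differentiable_def by blast

text \<open>Antisymmetrizing doubles \<i>/4 to \<i>/2, and the remaining 1/2 is absorbed by the two
  factors 1/sqrt 2 of the coframe.\<close>

lemma dtheta_frame:
  "dtheta v w - dtheta w v = - \<i> * (\<Sum>j\<in>UNIV. zeta j x v * zetabar j x w - zetabar j x v * zeta j x w)"
proof -
  have *: "\<i> / 4 * (cnj a * b - a * cnj b) - \<i> / 4 * (cnj b * a - b * cnj a)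
      = - \<i> * (a / sqrt2 * (cnj b / sqrt2) - cnj a / sqrt2 * (b / sqrt2))" for a b
    by (simp add: sqrt2_sqrt2) (simp add: field_simps)
  show ?thesis
    unfolding dtheta_def zeta_def zetabar_def sum_distrib_left sum_subtractf[symmetric] * ..
qed

section \<open>The exterior derivative in the coframe\<close>

text \<open>Products of \<open>zeta\<close> and \<open>zetabar\<close> are constant in affine
  coordinates, so in their product with \<open>theta\<close> only \<open>theta\<close> is
  differentiated.\<close>

context
  fixes \<omega> :: "'n::finite form"
  assumes const: "\<And>x y vs. \<omega> x vs = \<omega> y vs"
begin

lemma wedge_theta_const: "wedge theta \<omega> = (\<lambda>y vs. \<Sum>i<length vs. (-1) ^ i * \<omega> 0 (take i vs @ drop (Suc i) vs) * theta y (vs ! i))"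
  unfolding wedge_def by (intro ext sum.cong refl, subst const[of _ _ 0]) simp

lemma wedge_theta_differentiable: "(\<lambda>y. wedge theta \<omega> y vs) differentiable at x"
  unfolding wedge_theta_const
  by (intro differentiable_sum ballI differentiable_mult differentiable_const theta_differentiable) auto

lemma dir_deriv_wedge_theta:
  "dir_deriv v (\<lambda>y. wedge theta \<omega> y vs) x = wedge (\<lambda>_ w. dtheta v w) \<omega> x vs"
proof -
  have "dir_deriv v (\<lambda>y. wedge theta \<omega> y vs) x
    = (\<Sum>i<length vs. (-1) ^ i * \<omega> 0 (take i vs @ drop (Suc i) vs) * dtheta v (vs ! i))"
    unfolding wedge_theta_const
    by (subst dir_deriv_sum)
       (auto intro!: differentiable_mult theta_differentiable sum.cong
         simp: dir_deriv_cmult[OF theta_differentiable] dir_deriv_theta)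
  then show ?thesis by (simp add: wedge_def const[of x _ 0] mult_ac)
qed

end

lemma ext_d_diff:
  assumes "\<And>vs. (\<lambda>y. \<omega> y vs) differentiable at x" "\<And>vs. (\<lambda>y. \<eta> y vs) differentiable at x"
  shows "ext_d (\<lambda>y vs. \<omega> y vs - \<eta> y vs) x vs = ext_d \<omega> x vs - ext_d \<eta> x vs"
proof -
  have *: "dir_deriv v (\<lambda>y. \<omega> y vs - \<eta> y vs) x = dir_deriv v (\<lambda>y. \<omega> y vs) x - dir_deriv v (\<lambda>y. \<eta> y vs) x" for v vs
    using dir_deriv_add[OF assms(1), of "\<lambda>y. (-1) * \<eta> y vs" v vs] assms(2)[of vs]
    by (simp add: dir_deriv_cmult[where c = "-1", simplified])
  show ?thesis by (simp only: ext_d_def * right_diff_distrib sum_subtractf)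
qed

text \<open>For constant \<open>\<omega>\<close> this is the exterior product of d\<theta> with
  \<open>\<omega>\<close>. The induction peels off the first vector \<open>v\<close>: both sides
  obey the same recursion, whose inner instance is the contraction \<open>\<eta>\<close> of
  \<open>\<omega>\<close> with \<open>v\<close>.\<close>

lemma ext_d_theta_wedge:
  fixes \<omega> :: "'n::finite form"
  assumes "\<And>x y vs. \<omega> x vs = \<omega> y vs"
  shows "ext_d (wedge theta \<omega>) x vs = - \<i> * (\<Sum>j\<in>UNIV. wedge (zeta j) (wedge (zetabar j) \<omega>) x vs)"
  using assms
proof (induction vs arbitrary: \<omega>)
  case Nil
  then show ?case by (simp add: ext_d_def wedge_Nil)
next
  case (Cons v vs)
  note const = Cons.prems
  define \<eta> where "\<eta> = (\<lambda>y ws. \<omega> y (v # ws))"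
  have const': "\<eta> x vs = \<eta> y vs" for x y vs unfolding \<eta>_def by (rule const)
  have e: "(\<lambda>y. theta y v * \<omega> y ws) = (\<lambda>y. \<omega> x ws * theta y v)" for ws
    by (rule ext, subst const[of _ ws x], rule mult.commute)
  have d: "(\<lambda>y. theta y v * \<omega> y ws) differentiable at x" for ws
    unfolding e by (intro differentiable_mult theta_differentiable differentiable_const)
  have "ext_d (\<lambda>y ws. theta y v * \<omega> y ws) x vs = wedge (\<lambda>_ w. dtheta w v) \<omega> x vs"
  proof -
    have "dir_deriv w (\<lambda>y. theta y v * \<omega> y ws) x = dtheta w v * \<omega> x ws" for w ws
      unfolding e dir_deriv_cmult[OF theta_differentiable] dir_deriv_theta by (rule mult.commute)
    then show ?thesis by (simp add: ext_d_def wedge_def mult_ac)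
  qed
  moreover have "ext_d (wedge theta \<omega>) x (v # vs) = wedge (\<lambda>_ w. dtheta v w) \<omega> x vs
     - (ext_d (\<lambda>y ws. theta y v * \<omega> y ws) x vs - ext_d (wedge theta \<eta>) x vs)"
    unfolding ext_d_Cons dir_deriv_wedge_theta[OF const] wedge_Cons[where V = "\<lambda>_. v"] \<eta>_def[symmetric]
    by (subst ext_d_diff[OF d wedge_theta_differentiable[OF const']]) simp
  \<comment> \<open>The derivatives of \<open>theta\<close> along \<open>v\<close> and at
    \<open>v\<close> combine to the contraction of d\<theta> with \<open>v\<close>.\<close>
  moreover have "wedge (\<lambda>_ w. dtheta v w) \<omega> x vs - wedge (\<lambda>_ w. dtheta w v) \<omega> x vs
    = - \<i> * (\<Sum>j\<in>UNIV. zeta j x v * wedge (zetabar j) \<omega> x vs - zetabar j x v * wedge (zeta j) \<omega> x vs)"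
  proof -
    have "wedge (\<lambda>_ w. dtheta v w) \<omega> x vs - wedge (\<lambda>_ w. dtheta w v) \<omega> x vs
       = (\<Sum>i<length vs. (-1) ^ i * (dtheta v (vs ! i) - dtheta (vs ! i) v) * \<omega> x (take i vs @ drop (Suc i) vs))"
      by (simp add: wedge_def sum_subtractf algebra_simps)
    also have "\<dots> = (\<Sum>i<length vs. \<Sum>j\<in>UNIV. - \<i> * (zeta j x v * ((-1) ^ i * zetabar j x (vs ! i) * \<omega> x (take i vs @ drop (Suc i) vs))
         - zetabar j x v * ((-1) ^ i * zeta j x (vs ! i) * \<omega> x (take i vs @ drop (Suc i) vs))))"
      unfolding dtheta_frame[where x = x] sum_distrib_left sum_distrib_right
      by (intro sum.cong refl) (simp add: algebra_simps)
    also have "\<dots> = - \<i> * (\<Sum>j\<in>UNIV. zeta j x v * wedge (zetabar j) \<omega> x vs - zetabar j x v * wedge (zeta j) \<omega> x vs)"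
      unfolding sum_distrib_left wedge_def sum_subtractf[symmetric] by (rule sum.swap)
    finally show ?thesis .
  qed
  moreover have "wedge (zeta j) (wedge (zetabar j) \<omega>) x (v # vs)
     = zeta j x v * wedge (zetabar j) \<omega> x vs - zetabar j x v * wedge (zeta j) \<omega> x vs
       + wedge (zeta j) (wedge (zetabar j) \<eta>) x vs" for j
    unfolding wedge_Cons[where V = "\<lambda>_. v"] wedge_diff \<eta>_def[symmetric]
    by (simp add: wedge_def zetabar_def sum_distrib_left mult_ac)
  moreover have "a - (b - c) = (a - b) + c" for a b c :: complex by simp
  ultimately show ?case
    by (simp only: sum.distrib distrib_left Cons.IH[OF const'])
qed

lemma gprod_const:
  assumes "Th \<notin> set as"
  shows "gprod as x vs = gprod as y vs"
  using assms
proof (induction as arbitrary: vs)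
  case Nil
  then show ?case by (simp add: gprod_def)
next
  case (Cons a as)
  then have "gform a x v = gform a y v" for v
    by (cases a) (auto simp: zeta_def zetabar_def)
  moreover have "gprod as x ws = gprod as y ws" for ws using Cons by auto
  ultimately show ?case by (simp add: gprod_Cons wedge_def)
qed

lemma basis_form_const: "basis_form (I, J, False) x vs = basis_form (I, J, False) y vs"
  unfolding basis_form_gprod by (rule gprod_const) auto

lemma basis_form_theta: "basis_form (I, J, True) = wedge theta (basis_form (I, J, False))"
  unfolding basis_form_gprod by (simp add: gprod_Cons)

lemma basis_form_differentiable: "(\<lambda>y. basis_form A y vs) differentiable at x"
proof (cases A)
  case (fields I J b)
  show ?thesis
  proof (cases b)
    case True
    then have A: "A = (I, J, True)" using fields by simp
    show ?thesis unfolding A basis_form_theta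
      by (rule wedge_theta_differentiable) (rule basis_form_const)
  next
    case False
    then have A: "A = (I, J, False)" using fields by simp
    have "(\<lambda>y. basis_form A y vs) = (\<lambda>y. basis_form A x vs)"
      unfolding A by (intro ext basis_form_const)
    then show ?thesis by (simp only: differentiable_const)
  qed
qed

text \<open>\<open>contract Th\<close> strips \<open>theta\<close> where it occurs and gives 0
  elsewhere, so one formula covers both kinds of basis form.\<close>

lemma ext_d_basis_form:
  "ext_d (basis_form A) x vs
    = - \<i> * (\<Sum>j\<in>UNIV. wedge (zeta j) (wedge (zetabar j) (contract Th (basis_form A))) x vs)"
proof (cases A)
  case (fields I J b)
  show ?thesis
  proof (cases b)
    case True
    then have A: "A = (I, J, True)" using fields by simp
    have "contract Th (basis_form (I, J, False)) = (\<lambda>x vs. 0)"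
      by (intro ext contract_basis_form) simp
    have "contract Th (basis_form A) = basis_form (I, J, False)"
      unfolding A basis_form_theta
      by (intro ext) (simp only: contract_wedge[of Th Th, simplified gform.simps] wedge_zero
          \<open>contract Th (basis_form (I, J, False)) = _\<close> if_True diff_zero simp_thms)
    show ?thesis
      unfolding \<open>contract Th (basis_form A) = _\<close>
      unfolding A basis_form_theta by (rule ext_d_theta_wedge) (rule basis_form_const)
  next
    case False
    then have A: "A = (I, J, False)" using fields by simp
    have "(\<lambda>y. basis_form A y ws) = (\<lambda>y. basis_form A x ws)" for ws
      unfolding A by (intro ext basis_form_const)
    then have "ext_d (basis_form A) x vs = 0"
      by (simp only: ext_d_def dir_deriv_const mult_zero_right sum.neutral_const)
    moreover have "contract Th (basis_form A) = (\<lambda>x vs. 0)"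
      unfolding A by (intro ext contract_basis_form) simp
    moreover have "wedge (zetabar j) (\<lambda>x vs. 0) = (\<lambda>x vs. 0)" for j :: 'a
      by (intro ext wedge_zero)
    ultimately show ?thesis by (simp only: wedge_zero sum.neutral_const mult_zero_right)
  qed
qed

text \<open>The Leibniz rule: differentiated coefficients give the first three terms through
  \<open>dir_deriv_frame\<close>, differentiated basis forms give the last.\<close>

lemma ext_d_form_of:
  assumes c: "\<And>A x. c A differentiable at x"
  shows "ext_d (form_of c) = form_of (\<lambda>A x. (\<Sum>j\<in>UNIV. eps (Ze j) (\<lambda>B. vfZ j (c B)) A x)
    + (\<Sum>j\<in>UNIV. eps (Zb j) (\<lambda>B. vfZbar j (c B)) A x) + eps Th (\<lambda>B. vfT (c B)) A x
    - \<i> * (\<Sum>j\<in>UNIV. eps (Ze j) (eps (Zb j) (iota Th c)) A x))"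
proof (intro ext)
  fix x vs
  have "ext_d (form_of c) x vs
    = (\<Sum>A\<in>UNIV. wedge (\<lambda>x v. dir_deriv v (c A) x) (basis_form A) x vs + c A x * ext_d (basis_form A) x vs)"
  proof -
    have "dir_deriv v (\<lambda>y. form_of c y ws) x
      = (\<Sum>A\<in>UNIV. dir_deriv v (c A) x * basis_form A x ws + c A x * dir_deriv v (\<lambda>y. basis_form A y ws) x)" for v ws
      unfolding form_of_def
      by (subst dir_deriv_sum)
         (simp_all only: dir_deriv_mult[OF c basis_form_differentiable]
           differentiable_mult[OF c basis_form_differentiable] add.commute[of "_ * dir_deriv v _ x"])
    then have "ext_d (form_of c) x vs = (\<Sum>i<length vs. \<Sum>A\<in>UNIV.
        (-1) ^ i * (dir_deriv (vs ! i) (c A) x * basis_form A x (take i vs @ drop (Suc i) vs)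
        + c A x * dir_deriv (vs ! i) (\<lambda>y. basis_form A y (take i vs @ drop (Suc i) vs)) x))"
      by (simp only: ext_d_def sum_distrib_left)
    also have "\<dots> = (\<Sum>A\<in>UNIV. \<Sum>i<length vs.
        (-1) ^ i * (dir_deriv (vs ! i) (c A) x * basis_form A x (take i vs @ drop (Suc i) vs)
        + c A x * dir_deriv (vs ! i) (\<lambda>y. basis_form A y (take i vs @ drop (Suc i) vs)) x))"
      by (rule sum.swap)
    also have "\<dots> = (\<Sum>A\<in>UNIV. wedge (\<lambda>x v. dir_deriv v (c A) x) (basis_form A) x vs + c A x * ext_d (basis_form A) x vs)"
      unfolding wedge_def ext_d_def sum_distrib_left sum.distrib[symmetric]
      by (intro sum.cong refl) (simp add: algebra_simps)
    finally show ?thesis .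
  qed
  also have "\<dots> = (\<Sum>A\<in>UNIV. (\<Sum>j\<in>UNIV. vfZ j (c A) x * wedge (zeta j) (basis_form A) x vs)
      + (\<Sum>j\<in>UNIV. vfZbar j (c A) x * wedge (zetabar j) (basis_form A) x vs)
      + vfT (c A) x * wedge theta (basis_form A) x vs
      - \<i> * (\<Sum>j\<in>UNIV. c A x * wedge (zeta j) (wedge (zetabar j) (contract Th (basis_form A))) x vs))"
  proof (rule sum.cong)
    fix A :: "'a findex"
    have "wedge (\<lambda>x v. dir_deriv v (c A) x) (basis_form A) x vs
       = wedge (\<lambda>x v. (\<Sum>j\<in>UNIV. vfZ j (c A) x * zeta j x v) + (\<Sum>j\<in>UNIV. vfZbar j (c A) x * zetabar j x v)
    + vfT (c A) x * theta x v) (basis_form A) x vs"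
      by (simp only: dir_deriv_frame[OF c])
    also have "\<dots> = (\<Sum>j\<in>UNIV. vfZ j (c A) x * wedge (zeta j) (basis_form A) x vs)
      + (\<Sum>j\<in>UNIV. vfZbar j (c A) x * wedge (zetabar j) (basis_form A) x vs)
      + vfT (c A) x * wedge theta (basis_form A) x vs"
      by (simp only: wedge_add_left wedge_sum_left wedge_cmult_left)
    finally show "wedge (\<lambda>x v. dir_deriv v (c A) x) (basis_form A) x vs + c A x * ext_d (basis_form A) x vs
      = (\<Sum>j\<in>UNIV. vfZ j (c A) x * wedge (zeta j) (basis_form A) x vs)
      + (\<Sum>j\<in>UNIV. vfZbar j (c A) x * wedge (zetabar j) (basis_form A) x vs)
      + vfT (c A) x * wedge theta (basis_form A) x vs
      - \<i> * (\<Sum>j\<in>UNIV. c A x * wedge (zeta j) (wedge (zetabar j) (contract Th (basis_form A))) x vs)"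
      by (simp only: ext_d_basis_form sum_distrib_left[symmetric]) simp
  qed simp
  also have "\<dots> = (\<Sum>j\<in>UNIV. wedge (zeta j) (form_of (\<lambda>B. vfZ j (c B))) x vs)
    + (\<Sum>j\<in>UNIV. wedge (zetabar j) (form_of (\<lambda>B. vfZbar j (c B))) x vs)
    + wedge theta (form_of (\<lambda>B. vfT (c B))) x vs
    - \<i> * (\<Sum>j\<in>UNIV. wedge (zeta j) (wedge (zetabar j) (contract Th (form_of c))) x vs)"
  proof -
    have w: "wedge \<alpha> (form_of d) x vs = (\<Sum>A\<in>UNIV. d A x * wedge \<alpha> (basis_form A) x vs)" for \<alpha> d
      unfolding form_of_def wedge_sum wedge_cmult ..
    have w2: "wedge \<alpha> (wedge \<beta> (contract Th (form_of c))) x vs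
       = (\<Sum>A\<in>UNIV. c A x * wedge \<alpha> (wedge \<beta> (contract Th (basis_form A))) x vs)" for \<alpha> \<beta>
    proof -
      have "contract Th (form_of c) = (\<lambda>x vs. \<Sum>A\<in>UNIV. c A x * contract Th (basis_form A) x vs)"
        unfolding form_of_def by (intro ext) (simp only: contract_sum contract_cmult)
      moreover have "wedge \<beta> \<dots> = (\<lambda>x vs. \<Sum>A\<in>UNIV. c A x * wedge \<beta> (contract Th (basis_form A)) x vs)"
        by (intro ext) (simp only: wedge_sum wedge_cmult)
      ultimately show ?thesis by (simp only: wedge_sum wedge_cmult)
    qed
    show ?thesis
      unfolding w w2 sum.distrib sum_subtractf sum_distrib_left[symmetric]
      by (intro arg_cong2[of _ _ _ _ "(+)"] arg_cong2[of _ _ _ _ "(-)"] arg_cong[of _ _ "(*) \<i>"] sum.swap refl)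
         (simp only: sum_distrib_left, rule sum.swap)
  qed
  also have "\<dots> = form_of (\<lambda>A x. (\<Sum>j\<in>UNIV. eps (Ze j) (\<lambda>B. vfZ j (c B)) A x)
    + (\<Sum>j\<in>UNIV. eps (Zb j) (\<lambda>B. vfZbar j (c B)) A x) + eps Th (\<lambda>B. vfT (c B)) A x
    - \<i> * (\<Sum>j\<in>UNIV. eps (Ze j) (eps (Zb j) (iota Th c)) A x)) x vs"
    unfolding form_of_diff form_of_add form_of_cmult form_of_sum
    unfolding wedge_form_of[symmetric] contract_form_of[symmetric] gform.simps ..
  finally show "ext_d (form_of c) x vs = \<dots>" .
qed

section \<open>Schwartz forms and their formal adjoints\<close>

text \<open>With the Schwartz condition built into the type, all operators are total additive maps,
  and their identities can be computed by rewriting without side conditions.\<close>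

typedef ('n::"{finite,linorder}") sform = "{c :: 'n findex \<Rightarrow> 'n heis \<Rightarrow> complex. \<forall>A. schwartz (c A)}"
  morphisms scoeff Sform
  by (rule exI[of _ "\<lambda>A x. 0"]) (simp add: schwartz_zero)

setup_lifting type_definition_sform

lemma schwartz_scoeff: "schwartz (scoeff s A)"
  using scoeff[of s] by blast

lemma sform_eqI: "(\<And>A x. scoeff s A x = scoeff t A x) \<Longrightarrow> s = t"
  by (metis ext scoeff_inject)

lemma schwartz_uminus: "schwartz f \<Longrightarrow> schwartz (\<lambda>x. - f x)"
  using schwartz_cmult[of f "-1"] by simp

lemma schwartz_diff: "schwartz f \<Longrightarrow> schwartz g \<Longrightarrow> schwartz (\<lambda>x. f x - g x)"
  using schwartz_add[of f "\<lambda>x. - g x"] by (simp add: schwartz_uminus)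

instantiation sform :: ("{finite,linorder}") ab_group_add
begin

lift_definition zero_sform :: "'a sform" is "\<lambda>A x. 0" by (simp add: schwartz_zero)
lift_definition plus_sform :: "'a sform \<Rightarrow> 'a sform \<Rightarrow> 'a sform" is "\<lambda>c d A x. c A x + d A x"
  by (simp add: schwartz_add)
lift_definition minus_sform :: "'a sform \<Rightarrow> 'a sform \<Rightarrow> 'a sform" is "\<lambda>c d A x. c A x - d A x"
  by (simp add: schwartz_diff)
lift_definition uminus_sform :: "'a sform \<Rightarrow> 'a sform" is "\<lambda>c A x. - c A x"
  by (simp add: schwartz_uminus)

instance
  by standard (transfer, simp add: algebra_simps)+

end

lemma scoeff_simps:
  "scoeff 0 A x = 0" "scoeff (s + t) A x = scoeff s A x + scoeff t A x"
  "scoeff (s - t) A x = scoeff s A x - scoeff t A x" "scoeff (- s) A x = - scoeff s A x"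
  by (transfer, simp)+

lemma scoeff_sum: "scoeff (\<Sum>i\<in>I. s i) A x = (\<Sum>i\<in>I. scoeff (s i) A x)"
  by (induction I rule: infinite_finite_induct) (auto simp: scoeff_simps)

lemma scoeff_add_fun: "scoeff (s + t) A = (\<lambda>x. scoeff s A x + scoeff t A x)"
  by (rule ext) (rule scoeff_simps)

lift_definition scale :: "complex \<Rightarrow> 'n::{finite,linorder} sform \<Rightarrow> 'n sform" is "\<lambda>a c A x. a * c A x"
  by (simp add: schwartz_cmult)

text \<open>The case distinction stands outside the function of the base point, where differential
  operators can pass it.\<close>

lemma eps_if: "eps a c A = (if gmem a A then (\<lambda>x. gsign a (grem a A) * c (grem a A) x) else (\<lambda>x. 0))"
  by (auto simp: eps_def)

lemma iota_if: "iota a c A = (if gmem a A then (\<lambda>x. 0) else (\<lambda>x. gsign a A * c (gins a A) x))"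
  by (auto simp: iota_def)

lift_definition wedg :: "'n gen \<Rightarrow> 'n::{finite,linorder} sform \<Rightarrow> 'n sform" is eps
  by (simp add: eps_if schwartz_cmult schwartz_zero)

lift_definition ctr :: "'n gen \<Rightarrow> 'n::{finite,linorder} sform \<Rightarrow> 'n sform" is iota
  by (simp add: iota_if schwartz_cmult schwartz_zero)

lift_definition sZ :: "'n \<Rightarrow> 'n::{finite,linorder} sform \<Rightarrow> 'n sform" is "\<lambda>j c A. vfZ j (c A)"
  by (simp add: schwartz_vfZ)

lift_definition sZbar :: "'n \<Rightarrow> 'n::{finite,linorder} sform \<Rightarrow> 'n sform" is "\<lambda>j c A. vfZbar j (c A)"
  by (simp add: schwartz_vfZbar)

lift_definition sT :: "'n::{finite,linorder} sform \<Rightarrow> 'n sform" is "\<lambda>c A. vfT (c A)"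
  by (simp add: schwartz_vfT)

lemma scoeff_ops:
  "scoeff (scale a s) A x = a * scoeff s A x"
  "scoeff (wedg g s) A = eps g (scoeff s) A"
  "scoeff (ctr g s) A = iota g (scoeff s) A"
  "scoeff (sZ j s) A = vfZ j (scoeff s A)"
  "scoeff (sZbar j s) A = vfZbar j (scoeff s A)"
  "scoeff (sT s) A = vfT (scoeff s A)"
  by (transfer, simp)+

lemma scale_fun: "scoeff (scale a s) A = (\<lambda>x. a * scoeff s A x)"
  by (rule ext) (rule scoeff_ops)

lemma op_add:
  "scale a (s + t) = scale a s + scale a t" "wedg g (s + t) = wedg g s + wedg g t"
  "ctr g (s + t) = ctr g s + ctr g t" "sZ j (s + t) = sZ j s + sZ j t"
  "sZbar j (s + t) = sZbar j s + sZbar j t" "sT (s + t) = sT s + sT t"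
  by (rule sform_eqI, simp add: scoeff_ops scoeff_simps scoeff_add_fun eps_def iota_def distrib_left
      vfZ_add vfZbar_add vfT_add schwartz_scoeff)+

lemma additive_ops:
  "Modules.additive (scale a)" "Modules.additive (wedg g)" "Modules.additive (ctr g)" "Modules.additive (sZ j)" "Modules.additive (sZbar j)" "Modules.additive sT"
  by (simp_all add: Modules.additive_def op_add)

lemmas op_sum = additive_ops[THEN Modules.additive.sum]
lemmas op_minus = additive_ops[THEN Modules.additive.minus]
lemmas op_diff = additive_ops[THEN Modules.additive.diff]
lemmas op_zero = additive_ops[THEN Modules.additive.zero]
lemmas op_linear = op_add op_sum op_minus op_diff op_zero

lemma op_scale:
  "wedg g (scale a s) = scale a (wedg g s)" "ctr g (scale a s) = scale a (ctr g s)"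
  "sZ j (scale a s) = scale a (sZ j s)" "sZbar j (scale a s) = scale a (sZbar j s)"
  "sT (scale a s) = scale a (sT s)"
  by (rule sform_eqI, simp add: scoeff_ops scale_fun eps_def iota_def
      vfZ_cmult vfZbar_cmult vfT_cmult schwartz_scoeff)+

lemma ctr_anticommute: "ctr a (ctr b s) = - ctr b (ctr a s)"
  by (rule sform_eqI) (simp add: scoeff_simps, transfer, rule iota_anticommute)

lemma ctr_wedg: "ctr a (wedg b s) = (if a = b then s else 0) - wedg b (ctr a s)"
  by (rule sform_eqI) (simp add: scoeff_simps, transfer, simp add: iota_eps)

lemma vfZ_zero: "vfZ j (\<lambda>x. 0) = (\<lambda>x. 0)" and vfZbar_zero: "vfZbar j (\<lambda>x. 0) = (\<lambda>x. 0)"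
  by (simp_all add: vfZ_eq vfZbar_eq dir_deriv_const)

lemma field_wedg:
  "sZ j (wedg a s) = wedg a (sZ j s)" "sZbar j (wedg a s) = wedg a (sZbar j s)" "sT (wedg a s) = wedg a (sT s)"
  by (rule sform_eqI, simp add: scoeff_ops eps_if vfZ_cmult vfZbar_cmult vfT_cmult schwartz_scoeff
      vfZ_zero vfZbar_zero vfT_zero)+

lemma field_ctr:
  "sZ j (ctr a s) = ctr a (sZ j s)" "sZbar j (ctr a s) = ctr a (sZbar j s)" "sT (ctr a s) = ctr a (sT s)"
  by (rule sform_eqI, simp add: scoeff_ops iota_if vfZ_cmult vfZbar_cmult vfT_cmult schwartz_scoeff
      vfZ_zero vfZbar_zero vfT_zero)+

lemma field_commute:
  "sZ j (sZ k s) = sZ k (sZ j s)" "sZbar j (sZbar k s) = sZbar k (sZbar j s)"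
  "sT (sZ j s) = sZ j (sT s)" "sT (sZbar j s) = sZbar j (sT s)"
  by (rule sform_eqI, simp only: scoeff_ops vfZ_vfZ_commute[OF schwartz_scoeff, of j k]
      vfZbar_vfZbar_commute[OF schwartz_scoeff, of j k] vfT_vfZ[OF schwartz_scoeff] vfT_vfZbar[OF schwartz_scoeff])+

lemma sZ_sZbar: "sZ j (sZbar k s) = sZbar k (sZ j s) + (if j = k then scale \<i> (sT s) else 0)"
  by (rule sform_eqI) (simp add: scoeff_ops scoeff_simps vfZ_vfZbar_commutator[OF schwartz_scoeff])

definition to_form :: "'n::{finite,linorder} sform \<Rightarrow> 'n form" where
  "to_form s = form_of (scoeff s)"

lemma to_form_add: "to_form (s + t) = (\<lambda>x vs. to_form s x vs + to_form t x vs)"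
  unfolding to_form_def by (subst form_of_add[symmetric]) (simp add: scoeff_add_fun[abs_def])

lemma to_form_zero: "to_form 0 = (\<lambda>x vs. 0)"
  by (simp add: to_form_def zero_sform.rep_eq form_of_zero)

lemma to_form_sum: "to_form (\<Sum>i\<in>I. s i) = (\<lambda>x vs. \<Sum>i\<in>I. to_form (s i) x vs)"
  by (induction I rule: infinite_finite_induct) (auto simp: to_form_zero to_form_add)

lemma to_form_inject: "to_form s = to_form t \<longleftrightarrow> s = t"
  by (simp add: to_form_def form_of_inject scoeff_inject)

lemma coeffwise_to_form: "coeffwise P (to_form s) = form_of (\<lambda>A. P (scoeff s A))"
  by (simp add: coeffwise_def to_form_def coeffs_form_of)

lemma wedge_to_form: "wedge (gform a) (to_form s) = to_form (wedg a s)"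
  by (simp add: to_form_def wedge_form_of wedg.rep_eq)

definition s_del :: "'n::{finite,linorder} sform \<Rightarrow> 'n sform" where
  "s_del s = (\<Sum>j\<in>UNIV. wedg (Ze j) (sZ j s))"

definition s_delbar :: "'n::{finite,linorder} sform \<Rightarrow> 'n sform" where
  "s_delbar s = (\<Sum>j\<in>UNIV. wedg (Zb j) (sZbar j s))"

text \<open>The last term multiplies the \<open>Th\<close>-contraction by d\<theta>; it is present
  because \<open>theta\<close> is not closed.\<close>

definition s_d :: "'n::{finite,linorder} sform \<Rightarrow> 'n sform" where
  "s_d s = s_del s + s_delbar s + wedg Th (sT s)
     - scale \<i> (\<Sum>j\<in>UNIV. wedg (Ze j) (wedg (Zb j) (ctr Th s)))"

text \<open>Obtained from \<open>s_del\<close> by turning \<open>wedg\<close> into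
  \<open>ctr\<close> and Z j into its adjoint - Zbar j.\<close>

definition s_del_adj :: "'n::{finite,linorder} sform \<Rightarrow> 'n sform" where
  "s_del_adj s = - (\<Sum>j\<in>UNIV. ctr (Ze j) (sZbar j s))"

definition s_delbar_adj :: "'n::{finite,linorder} sform \<Rightarrow> 'n sform" where
  "s_delbar_adj s = - (\<Sum>j\<in>UNIV. ctr (Zb j) (sZ j s))"

text \<open>Up to a constant, the adjoint of the exterior product with \<open>d\<theta> = -\<i> \<Sum>j. \<zeta>\<^sub>j \<and> \<zeta>bar\<^sub>j\<close>.\<close>

definition lefschetz_adj :: "'n::{finite,linorder} sform \<Rightarrow> 'n sform" where
  "lefschetz_adj s = (\<Sum>j\<in>UNIV. ctr (Ze j) (ctr (Zb j) s))"

text \<open>The last sign: conjugation turns \<open>- \<i>\<close> into \<open>\<i>\<close>, and the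
  reversed order of the two contractions in the adjoint, restored to that of
  \<open>lefschetz_adj\<close>, turns it back.\<close>

definition s_d_adj :: "'n::{finite,linorder} sform \<Rightarrow> 'n sform" where
  "s_d_adj s = s_del_adj s + s_delbar_adj s - sT (ctr Th s) - scale \<i> (wedg Th (lefschetz_adj s))"

lemma del_to_form: "del (to_form s) = to_form (s_del s)"
proof -
  have "form_of (\<lambda>A. vfZ j (scoeff s A)) = to_form (sZ j s)" for j
    by (simp add: to_form_def sZ.rep_eq)
  then show ?thesis
    unfolding del_def coeffwise_to_form s_del_def to_form_sum
    by (simp only: gform.simps(2)[symmetric] wedge_to_form)
qed

lemma delbar_to_form: "delbar (to_form s) = to_form (s_delbar s)"
proof -
  have "form_of (\<lambda>A. vfZbar j (scoeff s A)) = to_form (sZbar j s)" for j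
    by (simp add: to_form_def sZbar.rep_eq)
  then show ?thesis
    unfolding delbar_def coeffwise_to_form s_delbar_def to_form_sum
    by (simp only: gform.simps(3)[symmetric] wedge_to_form)
qed

lemma d_H_to_form: "d_H (to_form s) = to_form (s_del s + s_delbar s)"
  by (simp add: d_H_def del_to_form delbar_to_form to_form_add)

lemma ext_d_to_form: "ext_d (to_form s) = to_form (s_d s)"
proof -
  have "ext_d (to_form s) = form_of (scoeff (s_d s))"
    unfolding to_form_def
    by (subst ext_d_form_of[OF schwartz_differentiable[OF schwartz_scoeff]])
       (intro arg_cong[of _ _ form_of] ext,
        simp add: s_d_def s_del_def s_delbar_def scoeff_simps scoeff_sum scoeff_ops
          wedg.rep_eq ctr.rep_eq sZ.rep_eq sZbar.rep_eq sT.rep_eq)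
  then show ?thesis by (simp only: to_form_def)
qed

section \<open>The inner product and the formal adjoints\<close>

definition sip :: "'n::{finite,linorder} sform \<Rightarrow> 'n sform \<Rightarrow> complex" where
  "sip s t = l2_inner (to_form s) (to_form t)"

lemma sip_integral: "sip s t = (\<integral>x. (\<Sum>A\<in>UNIV. scoeff s A x * cnj (scoeff t A x)) \<partial>lborel)"
  by (simp add: sip_def l2_inner_def to_form_def coeffs_form_of)

lemma sip_pairing: "sip s t = (\<Sum>A\<in>UNIV. l2_pairing (scoeff s A) (scoeff t A))"
  unfolding sip_integral l2_pairing_def
  by (rule Bochner_Integration.integral_sum) (intro schwartz_pairing_integrable schwartz_scoeff)

lemma sip_add: "sip (s + t) u = sip s u + sip t u" "sip u (s + t) = sip u s + sip u t"
  by (simp_all add: sip_pairing scoeff_add_fun l2_pairing_add_left l2_pairing_add_right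
      schwartz_scoeff sum.distrib)

lemma sip_scale: "sip (scale a s) t = a * sip s t" "sip s (scale a t) = cnj a * sip s t"
  by (simp_all add: sip_pairing scale_fun l2_pairing_cmult_left l2_pairing_cmult_right sum_distrib_left)

lemma additive_sip: "Modules.additive (\<lambda>s. sip s t)" "Modules.additive (sip s)"
  by (simp_all add: Modules.additive_def sip_add)

lemmas sip_linear = sip_add sip_scale additive_sip[THEN Modules.additive.sum] additive_sip[THEN Modules.additive.minus]
  additive_sip[THEN Modules.additive.diff] additive_sip[THEN Modules.additive.zero]

lemma sip_wedg: "sip (wedg a s) t = sip s (ctr a t)"
proof -
  \<comment> \<open>The signs are real, so the bilinear transposition
    \<open>eps_iota_adjoint\<close> is also a Hermitian adjunction.\<close>
  have "cnj (iota a c A x) = iota a (\<lambda>A x. cnj (c A x)) A x" for c A x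
    by (auto simp: iota_def cnj_gsign)
  then show ?thesis
    by (simp add: sip_integral scoeff_ops eps_iota_adjoint[where d = "\<lambda>A x. cnj (scoeff t A x)"])
qed

lemma sip_fields:
  "sip (sZ j s) t = - sip s (sZbar j t)" "sip (sZbar j s) t = - sip s (sZ j t)" "sip (sT s) t = - sip s (sT t)"
  by (simp_all add: sip_pairing scoeff_ops l2_pairing_vfZ l2_pairing_vfZbar l2_pairing_vfT
      schwartz_scoeff sum_negf)

lemma sip_del: "sip (s_del s) t = sip s (s_del_adj t)"
  by (simp add: s_del_def s_del_adj_def sip_linear sip_wedg sip_fields field_ctr sum_negf)

lemma sip_delbar: "sip (s_delbar s) t = sip s (s_delbar_adj t)"
  by (simp add: s_delbar_def s_delbar_adj_def sip_linear sip_wedg sip_fields field_ctr sum_negf)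

lemma sip_d: "sip (s_d s) t = sip s (s_d_adj t)"
proof -
  have adj: "sip (ctr a s) t = sip s (wedg a t)" for a :: "'a gen" and s t
  proof -
    have cnj: "cnj (sip u v) = sip v u" for u v :: "'a sform"
      by (simp add: sip_pairing l2_pairing_cnj)
    have "sip (ctr a s) t = cnj (sip t (ctr a s))" by (simp add: cnj)
    also have "\<dots> = cnj (sip (wedg a t) s)" by (simp add: sip_wedg)
    finally show ?thesis by (simp add: cnj)
  qed
  have "sip (\<Sum>j\<in>UNIV. wedg (Ze j) (wedg (Zb j) (ctr Th s))) t = - sip s (wedg Th (lefschetz_adj t))"
    by (simp add: sip_linear sip_wedg adj lefschetz_adj_def op_linear ctr_anticommute[of "Zb _" "Ze _"] sum_negf)
  then show ?thesis
    by (simp add: s_d_def s_d_adj_def sip_linear sip_del sip_delbar sip_wedg sip_fields field_ctr)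
qed

lemma sip_eq_zero:
  assumes "sip s s = 0"
  shows "s = 0"
proof (rule sform_eqI)
  fix A x
  define f where "f = (\<lambda>x. \<Sum>A\<in>UNIV. (norm (scoeff s A x))\<^sup>2)"
  have cf: "complex_of_real (f x) = (\<Sum>A\<in>UNIV. scoeff s A x * cnj (scoeff s A x))" for x
    unfolding f_def of_real_sum by (intro sum.cong refl complex_norm_square)
  have "integrable lborel (\<lambda>x. complex_of_real (f x))"
    unfolding cf by (intro Bochner_Integration.integrable_sum schwartz_pairing_integrable schwartz_scoeff)
  then have int: "integrable lborel f" by (simp only: complex_of_real_integrable_eq)
  have "complex_of_real (\<integral>x. f x \<partial>lborel) = 0"
    using assms by (simp only: sip_integral cf[symmetric] integral_complex_of_real)
  then have zero: "(\<integral>x. f x \<partial>lborel) = 0" by (simp only: of_real_eq_0_iff)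
  have cont: "continuous_on UNIV f"
    unfolding f_def by (intro continuous_intros schwartz_continuous schwartz_scoeff)
  have "f x \<ge> 0" for x unfolding f_def by (intro sum_nonneg) simp
  from continuous_nonneg_integral_zero[OF cont this int zero] have "f x = 0" .
  then have "(norm (scoeff s A x))\<^sup>2 = 0"
    unfolding f_def by (subst (asm) sum_nonneg_eq_0_iff) auto
  then show "scoeff s A x = scoeff 0 A x" by (simp add: scoeff_simps)
qed

lemma span_forms_schwartz:
  "span_forms (Collect schwartz) S = to_form ` {s. \<forall>A. A \<notin> S \<longrightarrow> scoeff s A = (\<lambda>x. 0)}"
proof (intro equalityI subsetI)
  fix \<omega> :: "'a form" assume "\<omega> \<in> span_forms (Collect schwartz) S"
  then obtain c where c: "\<omega> = form_of c" "\<forall>A\<in>S. schwartz (c A)" "\<forall>A. A \<notin> S \<longrightarrow> c A = (\<lambda>x. 0)"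
    by (auto simp: span_forms_def)
  then have "\<forall>A. schwartz (c A)" using schwartz_zero by metis
  then have "scoeff (Sform c) = c" by (simp add: Sform_inverse)
  with c show "\<omega> \<in> to_form ` {s. \<forall>A. A \<notin> S \<longrightarrow> scoeff s A = (\<lambda>x. 0)}"
    by (intro image_eqI[of _ _ "Sform c"]) (auto simp: to_form_def)
qed (auto simp: span_forms_def to_form_def schwartz_scoeff)

text \<open>Since the adjoint is a description on a restricted space, the candidate must lie in that
  space, which is the support condition on \<open>u\<close>. Uniqueness results from testing with
  the difference of two candidates.\<close>

lemma l2_adjoint_to_form:
  assumes P: "\<And>s. P (to_form s) = to_form (P' s)"
    and adj: "\<And>s. sip (P' s) t = sip s u"
    and u: "\<And>A. A \<notin> S \<Longrightarrow> scoeff u A = (\<lambda>x. 0)"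
  shows "l2_adjoint (span_forms (Collect schwartz) S) P (to_form t) = to_form u"
  unfolding l2_adjoint_def
proof (rule the_equality)
  show "to_form u \<in> span_forms (Collect schwartz) S \<and>
    (\<forall>\<phi>\<in>span_forms (Collect schwartz) S. l2_inner (P \<phi>) (to_form t) = l2_inner \<phi> (to_form u))"
    using u by (auto simp: span_forms_schwartz P sip_def[symmetric] adj)
next
  fix \<eta> assume *: "\<eta> \<in> span_forms (Collect schwartz) S \<and>
    (\<forall>\<phi>\<in>span_forms (Collect schwartz) S. l2_inner (P \<phi>) (to_form t) = l2_inner \<phi> \<eta>)"
  then obtain v where v: "\<eta> = to_form v" "\<And>A. A \<notin> S \<Longrightarrow> scoeff v A = (\<lambda>x. 0)"
    by (auto simp: span_forms_schwartz)
  have "scoeff (u - v) A = (\<lambda>x. 0)" if "A \<notin> S" for A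
    using u[OF that] v(2)[OF that] by (intro ext) (simp add: scoeff_simps)
  then have "to_form (u - v) \<in> span_forms (Collect schwartz) S"
    by (auto simp: span_forms_schwartz)
  with * have "l2_inner (P (to_form (u - v))) (to_form t) = l2_inner (to_form (u - v)) \<eta>" by blast
  then have "sip (u - v) u = sip (u - v) v"
    by (simp add: v P sip_def[symmetric] adj)
  then have "sip (u - v) (u - v) = 0" by (simp add: additive_sip[THEN Modules.additive.diff])
  then have "u - v = 0" by (rule sip_eq_zero)
  then show "\<eta> = to_form u" by (simp add: v)
qed

section \<open>Commutation relations\<close>

text \<open>Off the diagonal everything anticommutes. At j = k the anticommutator of creation and
  annihilation leaves Zbar j (Z j s), and interchanging the fields leaves \<i> T times the number
  operator.\<close>

lemma del_del_adj: "s_del_adj (s_del s) = - s_del (s_del_adj s) - (\<Sum>j\<in>UNIV. sZbar j (sZ j s))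
    - scale \<i> (\<Sum>j\<in>UNIV. wedg (Ze j) (ctr (Ze j) (sT s)))"
proof -
  have "ctr (Ze j) (sZbar j (wedg (Ze k) (sZ k s)))
    = (if k = j then sZbar j (sZ j s) + scale \<i> (wedg (Ze j) (ctr (Ze j) (sT s))) else 0)
      - wedg (Ze k) (sZ k (ctr (Ze j) (sZbar j s)))" for j k
    by (auto simp: field_wedg field_ctr ctr_wedg sZ_sZbar op_linear op_scale)
  then show ?thesis
    by (simp add: s_del_adj_def s_del_def op_linear sum_subtractf sum.distrib sum_negf
        sum.swap[of "\<lambda>i j. wedg (Ze i) _"] field_wedg)
       (subst sum.swap, simp)
qed

text \<open>Here the fields are interchanged in the opposite order, so the \<open>T\<close>-term has
  the opposite sign.\<close>

lemma delbar_delbar_adj: "s_delbar_adj (s_delbar s) = - s_delbar (s_delbar_adj s) - (\<Sum>j\<in>UNIV. sZ j (sZbar j s))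
    + scale \<i> (\<Sum>j\<in>UNIV. wedg (Zb j) (ctr (Zb j) (sT s)))"
proof -
  have "ctr (Zb j) (sZ j (wedg (Zb k) (sZbar k s)))
    = (if k = j then sZ j (sZbar j s) - scale \<i> (wedg (Zb j) (ctr (Zb j) (sT s))) else 0)
      - wedg (Zb k) (sZbar k (ctr (Zb j) (sZ j s)))" for j k
    by (auto simp: field_wedg field_ctr ctr_wedg sZ_sZbar op_linear op_scale)
  then show ?thesis
    by (simp add: s_delbar_adj_def s_delbar_def op_linear sum_subtractf sum.distrib sum_negf
         field_wedg)
       (subst sum.swap, simp)
qed

text \<open>Generators of different type anticommute and the Zbar j commute among themselves, so no
  diagonal term remains. The mixed terms of the horizontal Laplacian vanish for this reason.\<close>

lemma del_delbar_adj: "s_del_adj (s_delbar s) = - s_delbar (s_del_adj s)"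
proof -
  have "ctr (Ze j) (sZbar j (wedg (Zb k) (sZbar k s))) = - wedg (Zb k) (sZbar k (ctr (Ze j) (sZbar j s)))" for j k
    by (simp add: field_wedg field_ctr ctr_wedg field_commute(2)[of j k])
  then show ?thesis
    by (simp add: s_del_adj_def s_delbar_def op_linear sum_negf) (subst sum.swap, simp)
qed

lemma delbar_del_adj: "s_delbar_adj (s_del s) = - s_del (s_delbar_adj s)"
proof -
  have "ctr (Zb j) (sZ j (wedg (Ze k) (sZ k s))) = - wedg (Ze k) (sZ k (ctr (Zb j) (sZ j s)))" for j k
    by (simp add: field_wedg field_ctr ctr_wedg field_commute(1)[of j k])
  then show ?thesis
    by (simp add: s_delbar_adj_def s_del_def op_linear sum_negf) (subst sum.swap, simp)
qed

text \<open>The contractions anticommute, so what survives is the commutator of Z j and Zbar j.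
  Dually, \<open>s_del\<close> and \<open>s_delbar\<close> fail to anticommute by the product with
  d\<theta> and \<open>T\<close>, up to sign.\<close>

lemma del_adj_delbar_adj:
  "s_del_adj (s_delbar_adj s) + s_delbar_adj (s_del_adj s) = - scale \<i> (sT (lefschetz_adj s))"
proof -
  have "ctr (Zb k) (sZ k (ctr (Ze j) (sZbar j s)))
    = - ctr (Ze j) (sZbar j (ctr (Zb k) (sZ k s))) - (if k = j then scale \<i> (sT (ctr (Ze j) (ctr (Zb j) s))) else 0)"
    for j k
    by (auto simp: field_ctr sZ_sZbar op_linear op_scale ctr_anticommute[of "Zb k"])
  then have "s_delbar_adj (s_del_adj s)
    = (\<Sum>k\<in>UNIV. \<Sum>j\<in>UNIV. - ctr (Ze j) (sZbar j (ctr (Zb k) (sZ k s))))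
      - (\<Sum>k\<in>UNIV. scale \<i> (sT (ctr (Ze k) (ctr (Zb k) s))))"
    by (simp add: s_del_adj_def s_delbar_adj_def op_linear sum_subtractf)
  moreover have "s_del_adj (s_delbar_adj s) = (\<Sum>k\<in>UNIV. \<Sum>j\<in>UNIV. ctr (Ze j) (sZbar j (ctr (Zb k) (sZ k s))))"
    unfolding s_del_adj_def s_delbar_adj_def
    by (simp add: op_linear sum_negf) (rule sum.swap)
  ultimately show ?thesis
    by (simp add: lefschetz_adj_def op_linear sum_negf)
qed

text \<open>Only \<open>ctr (Ze j)\<close> can remove the new factor \<open>Ze j\<close>; to reach
  it, the factor first passes \<open>ctr (Zb j)\<close>, which supplies the sign hidden in
  \<open>s_delbar_adj\<close>.\<close>

lemma lefschetz_adj_del: "lefschetz_adj (s_del s) = s_del (lefschetz_adj s) + s_delbar_adj s"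
proof -
  have "ctr (Ze j) (ctr (Zb j) (wedg (Ze k) (sZ k s)))
    = wedg (Ze k) (sZ k (ctr (Ze j) (ctr (Zb j) s))) - (if k = j then ctr (Zb j) (sZ j s) else 0)" for j k
    by (auto simp: ctr_wedg op_linear field_ctr)
  then show ?thesis
    by (simp add: lefschetz_adj_def s_del_def s_delbar_adj_def op_linear sum_subtractf) (rule sum.swap)
qed

text \<open>Now \<open>ctr (Zb j)\<close> meets the new factor directly, hence the sign opposite to
  that in \<open>lefschetz_adj_del\<close>.\<close>

lemma lefschetz_adj_delbar: "lefschetz_adj (s_delbar s) = s_delbar (lefschetz_adj s) - s_del_adj s"
proof -
  have "ctr (Ze j) (ctr (Zb j) (wedg (Zb k) (sZbar k s)))
    = wedg (Zb k) (sZbar k (ctr (Ze j) (ctr (Zb j) s))) + (if k = j then ctr (Ze j) (sZbar j s) else 0)" for j k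
    by (auto simp: ctr_wedg op_linear field_ctr)
  then show ?thesis
    by (simp add: lefschetz_adj_def s_delbar_def s_del_adj_def op_linear sum.distrib) (rule sum.swap)
qed

lemma sT_eq_zero: "sT s = 0 \<Longrightarrow> s = 0"
proof (rule sform_eqI)
  fix A x assume "sT s = 0"
  then have "vfT (scoeff s A) = (\<lambda>x. 0)" by (metis scoeff_ops(6) scoeff_simps(1) ext)
  from vfT_eq_zero_imp[OF schwartz_scoeff this] show "scoeff s A x = scoeff 0 A x"
    by (simp add: scoeff_simps)
qed

text \<open>The situation of forms in \<open>W0\<close>, expressed by formal adjoints. That such
  \<open>s\<close> is primitive in the usual sense is the content of
  \<open>lefschetz_adj_zero\<close>.\<close>

context
  fixes s :: "'n::{finite,linorder} sform"
  assumes primitive: "s_del_adj s = 0" "s_delbar_adj s = 0"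
    and hor: "ctr Th s = 0"
begin

lemma lefschetz_adj_zero: "lefschetz_adj s = 0"
proof -
  have z: "s_del_adj 0 = (0 :: 'n sform)" "s_delbar_adj 0 = (0 :: 'n sform)"
    by (simp_all add: s_del_adj_def s_delbar_adj_def op_linear)
  have "scale \<i> (sT (lefschetz_adj s)) = 0"
    using del_adj_delbar_adj[of s] by (simp add: primitive z)
  then have "scale (- \<i>) (scale \<i> (sT (lefschetz_adj s))) = 0" by (simp add: op_linear)
  moreover have "scale (- \<i>) (scale \<i> t) = t" for t :: "'n sform"
    by (rule sform_eqI) (simp add: scoeff_ops)
  ultimately show ?thesis using sT_eq_zero by simp
qed

lemma s_d_adj_zero: "s_d_adj s = 0"
  by (simp add: s_d_adj_def primitive hor lefschetz_adj_zero op_linear)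

lemma s_d_adj_s_d: "s_d_adj (s_d s)
  = - (\<Sum>j\<in>UNIV. sZ j (sZbar j s) + sZbar j (sZ j s)) - sT (sT s)
    + scale \<i> (\<Sum>j\<in>UNIV. wedg (Zb j) (ctr (Zb j) (sT s)))
    - scale \<i> (\<Sum>j\<in>UNIV. wedg (Ze j) (ctr (Ze j) (sT s)))"
proof -
  define u where "u = s_del s + s_delbar s"
  have z: "s_del 0 = (0 :: 'n sform)" "s_delbar 0 = (0 :: 'n sform)"
    by (simp_all add: s_del_def s_delbar_def op_linear)
  have add: "s_del_adj (a + b) = s_del_adj a + s_del_adj b" "s_delbar_adj (a + b) = s_delbar_adj a + s_delbar_adj b"
    "lefschetz_adj (a + b) = lefschetz_adj a + lefschetz_adj b" for a b :: "'n sform"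
    by (simp_all add: s_del_adj_def s_delbar_adj_def lefschetz_adj_def op_linear sum.distrib)
  have d: "s_d s = u + wedg Th (sT s)"
    by (simp add: s_d_def u_def hor op_linear)
  have u0: "ctr Th u = 0"
    by (simp add: u_def s_del_def s_delbar_def op_linear ctr_wedg field_ctr[symmetric] hor)
  \<comment> \<open>The commutators of \<open>lefschetz_adj\<close> with the two operators leave
    adjoints applied to \<open>s\<close>, which vanish by assumption.\<close>
  have Lu: "lefschetz_adj u = 0"
    by (simp add: u_def add lefschetz_adj_del lefschetz_adj_delbar lefschetz_adj_zero primitive z)
  \<comment> \<open>\<open>T\<close> is central and contractions with horizontal generators
    anticommute with \<open>wedg Th\<close>, so the adjoints pass through to
    \<open>s\<close>.\<close>
  have adT: "s_del_adj (wedg Th (sT s)) = 0" "s_delbar_adj (wedg Th (sT s)) = 0"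
  proof -
    have "s_del_adj (wedg Th (sT s)) = - wedg Th (sT (s_del_adj s))"
      "s_delbar_adj (wedg Th (sT s)) = - wedg Th (sT (s_delbar_adj s))"
      by (simp_all add: s_del_adj_def s_delbar_adj_def field_wedg field_ctr field_commute ctr_wedg op_linear sum_negf)
    then show "s_del_adj (wedg Th (sT s)) = 0" "s_delbar_adj (wedg Th (sT s)) = 0"
      by (simp_all add: primitive op_linear)
  qed
  have LT: "wedg Th (lefschetz_adj (wedg Th (sT s))) = 0"
  proof -
    have "lefschetz_adj (wedg Th (sT s)) = wedg Th (sT (lefschetz_adj s))"
      by (simp add: lefschetz_adj_def ctr_wedg op_linear field_ctr)
    then show ?thesis by (simp add: lefschetz_adj_zero op_linear)
  qed
  have T: "sT (ctr Th (wedg Th (sT s))) = sT (sT s)"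
    by (simp add: ctr_wedg field_ctr[symmetric] hor op_linear)
  have "s_del_adj u + s_delbar_adj u = - (\<Sum>j\<in>UNIV. sZ j (sZbar j s) + sZbar j (sZ j s))
    + scale \<i> (\<Sum>j\<in>UNIV. wedg (Zb j) (ctr (Zb j) (sT s)))
    - scale \<i> (\<Sum>j\<in>UNIV. wedg (Ze j) (ctr (Ze j) (sT s)))"
    by (simp add: u_def add del_del_adj delbar_delbar_adj del_delbar_adj delbar_del_adj primitive z sum.distrib)
  then show ?thesis
    unfolding s_d_adj_def d
    by (simp add: add adT LT T Lu u0 op_add op_zero)
qed

end

text \<open>Number operators: the sign of \<open>wedg a\<close> cancels that of
  \<open>ctr a\<close>, so their composite projects onto the indices containing
  \<open>a\<close>.\<close>

lemma wedg_ctr_degree: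
  "scoeff (\<Sum>j\<in>UNIV. wedg (Ze j) (ctr (Ze j) s)) (I, J, b) x = of_nat (card I) * scoeff s (I, J, b) x"
  "scoeff (\<Sum>j\<in>UNIV. wedg (Zb j) (ctr (Zb j) s)) (I, J, b) x = of_nat (card J) * scoeff s (I, J, b) x"
proof -
  have e: "scoeff (wedg a (ctr a s)) A x = (if gmem a A then scoeff s A x else 0)" for a A
  proof -
    have "\<not> gmem a (grem a A)" by (simp add: gmem_grem)
    then show ?thesis
      by (simp add: scoeff_ops eps_def iota_def gins_grem mult.assoc[symmetric])
         (use gsign(1)[of a "grem a A"] in auto)
  qed
  have "(\<Sum>j\<in>UNIV. if j \<in> K then c else 0) = of_nat (card K) * c" for K :: "'a set" and c :: complex
    by (simp add: sum.If_cases)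
  then show "scoeff (\<Sum>j\<in>UNIV. wedg (Ze j) (ctr (Ze j) s)) (I, J, b) x = of_nat (card I) * scoeff s (I, J, b) x"
    "scoeff (\<Sum>j\<in>UNIV. wedg (Zb j) (ctr (Zb j) s)) (I, J, b) x = of_nat (card J) * scoeff s (I, J, b) x"
    by (simp_all add: scoeff_sum e)
qed

section \<open>Zero in the core\<close>

text \<open>Polynomial growth makes \<open>G\<close> square integrable against the Gaussian weight
  in \<open>hom_poly_eq_zero\<close>.\<close>

lemma hom_poly_bound:
  assumes "G \<in> hom_poly j"
  obtains K where "\<And>w. norm (G w) \<le> K * norm w ^ j"
proof -
  obtain c where c: "G = (\<lambda>w. \<Sum>\<alpha> | (\<Sum>i\<in>UNIV. \<alpha> i) = j. c \<alpha> * (\<Prod>i\<in>UNIV. (w $ i) ^ \<alpha> i))"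
    using assms by (auto simp: hom_poly_def)
  have "norm (G w) \<le> (\<Sum>\<alpha> | (\<Sum>i\<in>UNIV. \<alpha> i) = j. norm (c \<alpha>)) * norm w ^ j" for w
    unfolding c sum_distrib_right
  proof (rule sum_norm_le)
    fix \<alpha> :: "'a \<Rightarrow> nat" assume "\<alpha> \<in> {\<alpha>. (\<Sum>i\<in>UNIV. \<alpha> i) = j}"
    then have j: "(\<Sum>i\<in>UNIV. \<alpha> i) = j" by simp
    have "norm (\<Prod>i\<in>UNIV. (w $ i) ^ \<alpha> i) = (\<Prod>i\<in>UNIV. norm (w $ i) ^ \<alpha> i)"
      by (simp add: prod_norm[symmetric] norm_power)
    also have "\<dots> \<le> (\<Prod>i\<in>UNIV. norm w ^ \<alpha> i)"
      by (intro prod_mono conjI power_mono Finite_Cartesian_Product.norm_nth_le) auto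
    also have "\<dots> = norm w ^ j" by (simp add: power_sum[symmetric] j)
    finally show "norm (c \<alpha> * (\<Prod>i\<in>UNIV. (w $ i) ^ \<alpha> i)) \<le> norm (c \<alpha>) * norm w ^ j"
      by (simp add: norm_mult mult_left_mono)
  qed
  then show ?thesis by (rule that)
qed

lemma hom_poly_continuous: "G \<in> hom_poly j \<Longrightarrow> continuous_on UNIV G"
  by (auto simp: hom_poly_def intro!: continuous_intros)

text \<open>A single term of the exponential series at r^2 / 2 controls (r^2)^m; the summand 1 in
  the constant covers r \<le> 1.\<close>

lemma gaussian_decay: "\<exists>C. \<forall>r\<ge>0. r ^ m * exp (- (r\<^sup>2) / 2) \<le> (C :: real)"
proof (intro exI allI impI)
  fix r :: real assume "r \<ge> 0"
  have "r ^ m \<le> 1 + (r\<^sup>2) ^ m"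
  proof (cases "r \<le> 1")
    case True
    then show ?thesis using power_le_one[OF \<open>r \<ge> 0\<close> True, of m] by (simp add: add_increasing2)
  next
    case False
    then have "r ^ m \<le> r ^ (2 * m)" by (intro power_increasing) auto
    then show ?thesis by (simp add: power_mult)
  qed
  moreover have "(r\<^sup>2) ^ m * exp (- (r\<^sup>2) / 2) \<le> 2 ^ m * fact m"
  proof -
    have "(r\<^sup>2 / 2) ^ m / fact m \<le> exp (r\<^sup>2 / 2)"
    proof -
      have "(\<Sum>n\<in>{m}. (r\<^sup>2 / 2) ^ n /\<^sub>R fact n) \<le> (\<Sum>n. (r\<^sup>2 / 2) ^ n /\<^sub>R fact n)"
        by (rule sum_le_suminf[OF summable_exp_generic]) auto
      also have "\<dots> = exp (r\<^sup>2 / 2)" by (simp only: exp_def)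
      also have "(\<Sum>n\<in>{m}. (r\<^sup>2 / 2) ^ n /\<^sub>R fact n) = (r\<^sup>2 / 2) ^ m / fact m"
        by (simp add: field_simps)
      finally show ?thesis .
    qed
    then show ?thesis
      by (simp add: exp_minus field_simps power_divide)
  qed
  moreover have "exp (- (r\<^sup>2) / 2) \<le> 1" by simp
  moreover have "exp (- (r\<^sup>2) / 2) \<ge> 0" by simp
  ultimately show "r ^ m * exp (- (r\<^sup>2) / 2) \<le> 1 + 2 ^ m * fact m"
    using mult_right_mono[of "r ^ m" "1 + (r\<^sup>2) ^ m" "exp (- (r\<^sup>2) / 2)"]
    unfolding distrib_right mult_1 by linarith
qed

lemma hom_poly_eq_zero:
  assumes G: "G \<in> hom_poly j" and "fock_inner G G = 0"
  shows "G w = 0"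
proof -
  define f where "f = (\<lambda>w. (norm (G w))\<^sup>2 * exp (- (norm w)\<^sup>2 / 2))"
  have cf: "complex_of_real (f w) = G w * cnj (G w) * complex_of_real (exp (- (norm w)\<^sup>2 / 2))" for w
    by (simp only: f_def of_real_mult complex_norm_square)
  have cont: "continuous_on UNIV f"
    unfolding f_def by (intro continuous_intros hom_poly_continuous[OF G]) auto
  obtain K where K: "\<And>w. norm (G w) \<le> K * norm w ^ j" using hom_poly_bound[OF G] by blast
  \<comment> \<open>A non-integrable function has integral 0 by convention, so the vanishing of the
    inner product carries information only once integrability is known.\<close>
  have "integrable lborel (\<lambda>w. complex_of_real (f w))"
  proof (rule integrable_decay)
    show "(\<lambda>w. complex_of_real (f w)) \<in> borel_measurable borel"
      by (intro borel_measurable_continuous_onI continuous_intros cont)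
    fix N :: nat
    obtain C :: real where C: "\<And>r. r \<ge> 0 \<Longrightarrow> r ^ (N + 2 * j) * exp (- (r\<^sup>2) / 2) \<le> C"
      using gaussian_decay[of "N + 2 * j"] by blast
    have "norm w ^ N * norm (complex_of_real (f w)) \<le> K\<^sup>2 * C" for w
    proof -
      have "(norm (G w))\<^sup>2 \<le> (K * norm w ^ j)\<^sup>2" using K by (intro power_mono) auto
      then have "f w \<le> (K * norm w ^ j)\<^sup>2 * exp (- (norm w)\<^sup>2 / 2)"
        unfolding f_def by (intro mult_right_mono) auto
      then have "norm w ^ N * f w \<le> norm w ^ N * ((K * norm w ^ j)\<^sup>2 * exp (- (norm w)\<^sup>2 / 2))"
        by (intro mult_left_mono) auto
      also have "\<dots> = K\<^sup>2 * (norm w ^ (N + 2 * j) * exp (- (norm w)\<^sup>2 / 2))"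
        by (simp add: power_add power_mult_distrib power_mult[symmetric] mult_ac)
      also have "\<dots> \<le> K\<^sup>2 * C" by (intro mult_left_mono C) auto
      also have "norm w ^ N * f w = norm w ^ N * norm (complex_of_real (f w))"
        by (simp only: norm_of_real f_def abs_of_nonneg[OF mult_nonneg_nonneg[OF zero_le_power2 exp_ge_zero]])
      finally show ?thesis .
    qed
    then show "\<exists>C. \<forall>w. norm w ^ N * norm (complex_of_real (f w)) \<le> C" by blast
  qed
  then have int: "integrable lborel f" by (simp only: complex_of_real_integrable_eq)
  have "complex_of_real (\<integral>w. f w \<partial>lborel) = 0"
    using assms(2) by (simp only: fock_inner_def cf[symmetric] integral_complex_of_real)
  then have zero: "(\<integral>w. f w \<partial>lborel) = 0" by (simp only: of_real_eq_0_iff)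
  have "f w \<ge> 0" for w by (simp add: f_def)
  from continuous_nonneg_integral_zero[OF cont this int zero] have "f w = 0" .
  then show ?thesis by (simp add: f_def)
qed

lemma zero_in_hom_poly: "(\<lambda>w. 0) \<in> hom_poly j"
  unfolding hom_poly_def mem_Collect_eq by (rule exI[of _ "\<lambda>_. 0"]) simp

text \<open>Zero is a candidate, and any other is orthogonal to all homogeneous polynomials of its
  degree, in particular to itself.\<close>

lemma fock_proj_zero: "fock_proj j (\<lambda>w. 0) = (\<lambda>w. 0)"
  unfolding fock_proj_def
proof (rule the_equality)
  show "(\<lambda>w. 0) \<in> hom_poly j \<and> (\<forall>H\<in>hom_poly j. fock_inner (\<lambda>w. 0 - (0::complex)) H = 0)"
    using zero_in_hom_poly by (simp add: fock_inner_def)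
next
  fix G :: "complex ^ 'a \<Rightarrow> complex"
  assume G: "G \<in> hom_poly j \<and> (\<forall>H\<in>hom_poly j. fock_inner (\<lambda>w. 0 - G w) H = 0)"
  then have "fock_inner (\<lambda>w. 0 - G w) G = 0" by blast
  then have "fock_inner G G = 0" by (simp add: fock_inner_def)
  then show "G = (\<lambda>w. 0)" using hom_poly_eq_zero G by blast
qed

lemma rep_fun_zero: "rep_fun l (\<lambda>x. 0) F = (\<lambda>w. 0)"
  by (simp add: rep_fun_def)

text \<open>All operators attached to the zero function vanish, so any 0 < \<delta> < R serve as
  cutoffs.\<close>

lemma zero_in_core: "(\<lambda>x. 0) \<in> core"
  unfolding core_def mem_Collect_eq
  by (rule conjI[OF schwartz_zero], rule exI[of _ 1], rule exI[of _ 2], rule exI[of _ 0])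
     (simp add: rep_fun_zero fock_proj_zero)

lemma core_schwartz: "f \<in> core \<Longrightarrow> schwartz f"
  by (simp add: core_def)

text \<open>This is the value that \<open>Phi\<close> takes on \<open>W0\<close>, where the
  coefficients to be inverted are zero; it rests on zero being the one element of
  \<open>core\<close> in the kernel of \<open>vfT\<close>.\<close>

lemma the_inv_into_vfT_zero: "the_inv_into core vfT (\<lambda>x. 0) = (\<lambda>x. 0)"
  unfolding the_inv_into_def
  by (rule the_equality) (auto simp: zero_in_core vfT_zero intro: vfT_eq_zero_imp core_schwartz)

lemma scoeff_scalar_laplacian:
  "scoeff (- (\<Sum>j\<in>UNIV. sZ j (sZbar j s) + sZbar j (sZ j s)) - sT (sT s)) A x = scalar_laplacian (scoeff s A) x"
  by (simp add: scalar_laplacian_def sublaplacian_def scoeff_simps scoeff_sum scoeff_ops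
      sZ.rep_eq sZbar.rep_eq sT.rep_eq)

section \<open>The Laplacian on \<open>V0\<close>\<close>

theorem proposition6p1:
  fixes p q k :: nat and \<sigma> :: "'n::{finite,linorder} form"
  assumes "p + q \<le> CARD('n) - 1 \<or> (p + q = CARD('n) \<and> p * q = 0)"
    and "k = p + q"
    and "\<sigma> \<in> V0 p q"
  shows "hodge_laplacian k \<sigma>
    = coeffwise (\<lambda>f x. scalar_laplacian f x + \<i> * (of_nat q - of_nat p) * vfT f x) \<sigma>"
proof -
  obtain \<omega> where \<sigma>: "\<sigma> = Phi \<omega>" and "\<omega> \<in> W0 p q" using assms(3) by (auto simp: V0_def)
  then have \<omega>: "\<omega> \<in> span_forms core (bideg p q)"
    and adj: "del_adj \<omega> = (\<lambda>x vs. 0)" "delbar_adj \<omega> = (\<lambda>x vs. 0)"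
    by (auto simp: W0_def)
  have "\<omega> \<in> span_forms (Collect schwartz) (bideg p q)"
  proof -
    have "core \<subseteq> Collect schwartz" by (auto simp: core_def)
    with \<omega> show ?thesis unfolding span_forms_def by blast
  qed
  then obtain s where s: "\<omega> = to_form s" "\<And>A. A \<notin> bideg p q \<Longrightarrow> scoeff s A = (\<lambda>x. 0)"
    by (auto simp: span_forms_schwartz)
  have hor: "scoeff s (I, J, True) x = 0" for I J x
    using s(2)[of "(I, J, True)"] by (simp add: bideg_def)
  have hor': "ctr Th s = 0"
  proof (rule sform_eqI)
    fix A x show "scoeff (ctr Th s) A x = scoeff 0 A x"
      by (cases A) (simp add: scoeff_ops iota_def scoeff_simps hor)
  qed
  have ctr_hor: "scoeff (ctr a t) A = (\<lambda>x. 0)"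
    if "A \<notin> horizontal" "a \<noteq> Th" "\<And>I J x. scoeff t (I, J, True) x = 0" for a A and t :: "'n sform"
    using that by (cases A; cases a) (auto simp: horizontal_def scoeff_ops iota_def)
  have fields_hor: "scoeff (sZ j s) (I, J, True) x = 0" "scoeff (sZbar j s) (I, J, True) x = 0" for j I J x
    using s(2)[of "(I, J, True)"] by (simp_all add: bideg_def scoeff_ops vfZ_zero vfZbar_zero)
  \<comment> \<open>The adjoints are taken within horizontal forms, so the formal ones must be shown
    to have no \<open>theta\<close> component.\<close>
  have sup: "scoeff (s_del_adj s) A = (\<lambda>x. 0)" "scoeff (s_delbar_adj s) A = (\<lambda>x. 0)" if "A \<notin> horizontal" for A
    using ctr_hor[OF that] fields_hor
    by (auto simp: s_del_adj_def s_delbar_adj_def scoeff_simps scoeff_sum fun_eq_iff)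
  have "del_adj \<omega> = to_form (s_del_adj s)" "delbar_adj \<omega> = to_form (s_delbar_adj s)"
    unfolding s(1)
    by (rule l2_adjoint_to_form[OF del_to_form sip_del sup(1)] l2_adjoint_to_form[OF delbar_to_form sip_delbar sup(2)],
        assumption)+
  then have prim: "s_del_adj s = 0" "s_delbar_adj s = 0"
    by (simp_all add: adj to_form_zero[symmetric] to_form_inject)
  note ctx = prim hor'
  have "d_H_adj \<omega> = to_form 0"
    unfolding s(1)
    by (rule l2_adjoint_to_form[where P = d_H and P' = "\<lambda>s. s_del s + s_delbar s", OF d_H_to_form])
       (simp_all add: sip_add sip_del sip_delbar prim additive_sip[THEN Modules.additive.zero] zero_sform.rep_eq)
  then have "coeffwise (the_inv_into core vfT) (d_H_adj \<omega>) = (\<lambda>x vs. 0)"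
    by (simp add: coeffwise_to_form zero_sform.rep_eq the_inv_into_vfT_zero form_of_zero)
  then have \<sigma>s: "\<sigma> = to_form s"
    unfolding \<sigma> Phi_def by (simp add: wedge_zero s(1))
  \<comment> \<open>In degree 0 the codifferential is 0 by its own clause; in higher degrees it is
    an adjoint, computed by \<open>s_d_adj_zero\<close>.\<close>
  have codiff0: "codiff k (to_form s) = to_form 0"
  proof (cases k)
    case 0
    then show ?thesis by (simp add: to_form_zero)
  next
    case (Suc m)
    then show ?thesis
      by simp (rule l2_adjoint_to_form[where P = ext_d and P' = s_d, OF ext_d_to_form],
          simp_all add: sip_d s_d_adj_zero[OF ctx] zero_sform.rep_eq)
  qed
  define u where "u = s_d_adj (s_d s)"
  have u: "scoeff u A x = scalar_laplacian (scoeff s A) x + \<i> * (of_nat q - of_nat p) * vfT (scoeff s A) x" for A x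
  proof (cases A)
    case (fields I J b)
    \<comment> \<open>On \<open>bideg p q\<close> the cardinalities are \<open>p\<close> and
      \<open>q\<close>; elsewhere the coefficient vanishes and both sides are 0.\<close>
    have "of_nat (card I) * scoeff (sT s) (I, J, b) x = of_nat p * scoeff (sT s) (I, J, b) x"
      "of_nat (card J) * scoeff (sT s) (I, J, b) x = of_nat q * scoeff (sT s) (I, J, b) x"
      using s(2)[of "(I, J, b)"] by (auto simp: bideg_def scoeff_ops vfT_zero)
    then show ?thesis
      unfolding u_def s_d_adj_s_d[OF ctx] fields
      by (simp only: scoeff_simps(2,3)[of "_ - _" "scale _ _"] scoeff_simps(3)[of _ "scale _ _"] scoeff_scalar_laplacian scoeff_ops(1) wedg_ctr_degree)
         (simp add: scoeff_ops algebra_simps)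
  qed
  have "codiff (Suc k) (to_form (s_d s)) = to_form u"
  proof -
    \<comment> \<open>The adjoint is sought among \<open>k\<close>-forms. By the formula for
      \<open>u\<close>, each of its coefficients depends only on the same coefficient of
      \<open>s\<close>, so the degree is inherited.\<close>
    have "scoeff u A = (\<lambda>x. 0)" if "A \<notin> deg k" for A
    proof -
      have "A \<notin> bideg p q" using that assms(2) by (auto simp: deg_def bideg_def)
      then have "scoeff s A = (\<lambda>x. 0)" by (rule s(2))
      then show ?thesis
        by (intro ext) (simp add: u vfT_zero scalar_laplacian_def sublaplacian_def vfZ_zero vfZbar_zero)
    qed
    then show ?thesis
      by simp (rule l2_adjoint_to_form[where P = ext_d and P' = s_d, OF ext_d_to_form], simp_all add: sip_d u_def)
  qed
  then have "hodge_laplacian k \<sigma> = (\<lambda>x vs. ext_d (to_form (0 :: 'n sform)) x vs + to_form u x vs)"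
    unfolding hodge_laplacian_def \<sigma>s codiff0 ext_d_to_form by simp
  also have "ext_d (to_form (0 :: 'n sform)) = (\<lambda>x vs. 0)"
    unfolding ext_d_to_form
    by (simp add: s_d_def s_del_def s_delbar_def op_linear to_form_zero)
  also have "(\<lambda>x vs. 0 + to_form u x vs)
    = coeffwise (\<lambda>f x. scalar_laplacian f x + \<i> * (of_nat q - of_nat p) * vfT f x) \<sigma>"
    unfolding \<sigma>s coeffwise_to_form by (simp add: to_form_def u[symmetric] cong: arg_cong[of _ _ form_of])
  finally show ?thesis .
qed

end
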